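(* Let $0\le r<1$ and let $\mu$ be any positive Radon measure on $\mathbb{T}$ such that $\mu(\mathbb{T})\neq0$. Let $\varphi=P_r*\mu$. Then for any $f\in H_0^2(\mathbb{T})$, $$\left\|\frac{H_\varphi(f)}{\sqrt\varphi}\right\|_{L^\infty(\mathbb{T})}=\left\|\frac{R_+(\bar f\varphi)}{\sqrt\varphi}\right\|_{L^\infty(\mathbb{T})}\le\frac{r}{\sqrt{1-r^2}}\,\|f\|_{L^2(\mathbb{T};\varphi)} .$$ The constant $r/\sqrt{1-r^2}$ is optimal (for each given $r$, no smaller constant makes the inequality hold for all such $\mu$ and $f$). In particular, when $r=1/\sqrt2$ the inequality becomes $\left\|H_\varphi(f)/\sqrt\varphi\right\|_{L^\infty(\mathbb{T})}\le\|f\|_{L^2(\mathbb{T};\varphi)}$.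
   Context: $\mathbb{T}=\mathbb{R}/2\pi\mathbb{Z}$ with normalized Haar measure $m$. For $r\in[0,1)$, $P_r(e^{i\theta})=\frac{1}{2\pi}\sum_{n\in\mathbb{Z}}r^{|n|}e^{in\theta}=\frac1{2\pi}\frac{1-r^2}{|1-re^{i\theta}|^2}$ (with $P_0=\frac1{2\pi}$), and $(P_r*\mu)(e^{i\theta})=\int_{\mathbb{T}}P_r(e^{i(\theta-\theta')})d\mu(\theta')$. $H^2(\mathbb{T})$ is the set of $f(e^{i\theta})=\sum_{n\ge0}a_ne^{in\theta}$ with $\sum|a_n|^2<\infty$; $H^2_0(\mathbb{T})=\{f\in H^2(\mathbb{T}):\widehat f(0)=0\}$; $H^2_-(\mathbb{T})=L^2(\mathbb{T})\ominus H_0^2(\mathbb{T})$. $R_-:L^2(\mathbb{T})\to H_-^2(\mathbb{T})$ and $R_+:L^2(\mathbb{T})\to H^2(\mathbb{T})$ are the orthogonal projections (keeping the Fourier modes $n\le0$, respectively $n\ge0$). The Hankel operator is $H_\varphi(f)=R_-(\varphi f)$. $\|f\|_{L^2(\mathbb{T};\varphi)}=\big(\int_{\mathbb{T}}|f(e^{it})|^2\varphi(e^{it})dm(t)\big)^{1/2}$. *)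

theory Defs
  imports "HOL-Probability.Essential_Supremum"
begin

text \<open>
  The torus is realised as the unit circle \<open>sphere 0 1\<close> in the complex plane, the point
  \<open>e\<^sup>i\<^sup>\<theta>\<close> being \<open>cis \<theta>\<close>. Elements of \<open>L\<^sup>2\<close> are represented by Borel measurable
  functions, without passing to classes modulo null sets; only their values on the circle matter.
\<close>

definition circle_borel :: "complex measure" where
  "circle_borel = restrict_space borel (sphere 0 1)"

definition circle_haar :: "complex measure" where
  "circle_haar = distr (uniform_measure lborel {0..<2 * pi}) circle_borel cis"

definition radon_on_circle :: "complex measure \<Rightarrow> bool" where
  "radon_on_circle \<mu> \<longleftrightarrow>
     sets \<mu> = sets circle_borel \<and>
     (\<forall>K. compact K \<and> K \<subseteq> sphere 0 1 \<longrightarrow> emeasure \<mu> K < \<infinity>) \<and>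
     (\<forall>A\<in>sets \<mu>. emeasure \<mu> A = (SUP K\<in>{K. compact K \<and> K \<subseteq> A}. emeasure \<mu> K))"

text \<open>
  The Poisson kernel carries the factor \<open>1 / (2 * pi)\<close>, although \<open>circle_haar\<close> is normalised.
\<close>

definition poisson_kernel :: "real \<Rightarrow> complex \<Rightarrow> real" where
  "poisson_kernel r z = 1 / (2 * pi) * ((1 - r\<^sup>2) / (cmod (1 - of_real r * z))\<^sup>2)"

text \<open>For \<open>z\<close> and \<open>w\<close> on the circle, \<open>z / w\<close> is the point with argument \<open>Arg z - Arg w\<close>.\<close>

definition poisson_conv :: "real \<Rightarrow> complex measure \<Rightarrow> complex \<Rightarrow> real" where
  "poisson_conv r \<mu> z = (\<integral>w. poisson_kernel r (z / w) \<partial>\<mu>)"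

definition L2_circle :: "(complex \<Rightarrow> complex) set" where
  "L2_circle = {f \<in> borel_measurable circle_haar. integrable circle_haar (\<lambda>z. (cmod (f z))\<^sup>2)}"

definition L2_inner :: "(complex \<Rightarrow> complex) \<Rightarrow> (complex \<Rightarrow> complex) \<Rightarrow> complex" where
  "L2_inner f g = (\<integral>z. f z * cnj (g z) \<partial>circle_haar)"

definition weighted_L2_norm :: "(complex \<Rightarrow> real) \<Rightarrow> (complex \<Rightarrow> complex) \<Rightarrow> real" where
  "weighted_L2_norm \<phi> f = sqrt (\<integral>z. (cmod (f z))\<^sup>2 * \<phi> z \<partial>circle_haar)"

definition L2_norm_circle :: "(complex \<Rightarrow> complex) \<Rightarrow> real" where
  "L2_norm_circle f = weighted_L2_norm (\<lambda>_. 1) f"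

text \<open>
  The \<open>L\<^sup>\<infinity>\<close> norm is extended-real-valued, so that it is \<open>\<infinity>\<close> (rather than an arbitrary real)
  for unbounded functions.
\<close>

definition Linf_norm_circle :: "(complex \<Rightarrow> complex) \<Rightarrow> ereal" where
  "Linf_norm_circle g = esssup circle_haar (\<lambda>z. ereal (cmod (g z)))"

definition fourier_coeff :: "(complex \<Rightarrow> complex) \<Rightarrow> int \<Rightarrow> complex" where
  "fourier_coeff f n = (\<integral>z. f z * z powi (- n) \<partial>circle_haar)"

definition H2 :: "(complex \<Rightarrow> complex) set" where
  "H2 = {f \<in> L2_circle. \<exists>a :: nat \<Rightarrow> complex. summable (\<lambda>n. (cmod (a n))\<^sup>2) \<and>
           (\<lambda>N. L2_norm_circle (\<lambda>z. f z - (\<Sum>n<N. a n * z ^ n))) \<longlonglongrightarrow> 0}"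

definition H2_0 :: "(complex \<Rightarrow> complex) set" where
  "H2_0 = {f \<in> H2. fourier_coeff f 0 = 0}"

definition H2_minus :: "(complex \<Rightarrow> complex) set" where
  "H2_minus = {g \<in> L2_circle. \<forall>h\<in>H2_0. L2_inner g h = 0}"

text \<open>
  The projection of \<open>f\<close> is determined only up to a null set; the choice operator picks a
  representative.
\<close>

definition L2_proj :: "(complex \<Rightarrow> complex) set \<Rightarrow> (complex \<Rightarrow> complex) \<Rightarrow> complex \<Rightarrow> complex" where
  "L2_proj V f = (SOME g. g \<in> V \<and> (\<forall>h\<in>V. L2_inner (\<lambda>z. f z - g z) h = 0))"

definition R_minus :: "(complex \<Rightarrow> complex) \<Rightarrow> complex \<Rightarrow> complex" where
  "R_minus = L2_proj H2_minus"

definition R_plus :: "(complex \<Rightarrow> complex) \<Rightarrow> complex \<Rightarrow> complex" where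
  "R_plus = L2_proj H2"

definition hankel :: "(complex \<Rightarrow> complex) \<Rightarrow> (complex \<Rightarrow> complex) \<Rightarrow> complex \<Rightarrow> complex" where
  "hankel \<phi> f = R_minus (\<lambda>z. \<phi> z * f z)"

end

theory Submission
  imports Defs "HOL-Probability.Giry_Monad"
begin

text \<open>
  Write \<open>m\<close> for normalised Haar measure and \<open>\<phi>\<close> for \<open>poisson_conv r \<mu>\<close>. On the circle
  \<open>2 * pi * poisson_kernel r (z / w)\<close> equals both
  \<open>1 / (1 - x) + cnj (1 / (1 - x)) - 1\<close> and \<open>(1 - r\<^sup>2) / (cmod (1 - x))\<^sup>2\<close>, where
  \<open>x = r * z * cnj w\<close>.

  The first form splits the symbol into an analytic and a coanalytic part. Multiplying by
  \<open>f\<close> in \<open>H2_0\<close> and integrating in \<open>w\<close> gives, almost everywhere,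
  \<open>H_\<phi> f z = (1 / (2 * pi)) * (\<integral>w. f (r * w) / (1 - r * w * cnj z) \<partial>\<mu>)\<close>,
  where \<open>f (r * w)\<close> is the value in the disc of the holomorphic extension of \<open>f\<close>, and
  \<open>R_plus (cnj f * \<phi>)\<close> is the complex conjugate of this function
  (\<open>R_plus_eq_hardy_part\<close>, \<open>hankel_eq_cnj_hardy_part\<close>). Hence the two \<open>L\<^sup>\<infinity>\<close> norms agree.

  The second form says that the square of the Cauchy kernel is a multiple of the Poisson kernel, so
  that Cauchy--Schwarz in \<open>L\<^sup>2(\<mu>)\<close> bounds \<open>(cmod (H_\<phi> f z))\<^sup>2\<close> by
  \<open>\<phi> z / (2 * pi * (1 - r\<^sup>2))\<close> times the integral of \<open>(cmod (f (r * w)))\<^sup>2\<close> in \<open>\<mu>\<close>.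
  Since \<open>f\<close> vanishes at the origin, \<open>f z = z * g z\<close>; subharmonicity of \<open>(cmod g)\<^sup>2\<close>
  together with \<open>cmod g = cmod f\<close> on the circle bounds \<open>(cmod (f (r * w)))\<^sup>2\<close> by \<open>r\<^sup>2\<close>
  times the Poisson integral of \<open>(cmod f)\<^sup>2\<close> (\<open>dilate_sq_le\<close>). Integrating this in \<open>\<mu>\<close> and
  exchanging the integrals turns the kernel back into \<open>\<phi>\<close> and produces the weighted norm
  (\<open>hardy_part_sq_le\<close>). For the unit mass at \<open>1\<close> and \<open>f z = z\<close> every one of these
  inequalities is an equality, which makes the constant optimal (\<open>point_mass_extremal\<close>).

  That the integral formula really represents the projections is proved by density. \<open>H2\<close> is the
  \<open>L\<^sup>2\<close> closure of the analytic polynomials (\<open>H2_iff_approx\<close>), and \<open>f \<mapsto> \<phi> * f - H_\<phi> f\<close>,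
  with the integral in the place of \<open>H_\<phi> f\<close>, is linear and bounded on \<open>L\<^sup>2\<close>; so it is
  enough that it sends each \<open>z ^ k\<close> with \<open>k > 0\<close> into \<open>H2_0\<close>, where it can be computed
  (\<open>analytic_remainder_power\<close>).
\<close>

section \<open>Haar measure and square-integrable functions on the circle\<close>

lemma space_circle_borel [simp]: "space circle_borel = sphere 0 1"
  by (simp add: circle_borel_def space_restrict_space)

lemma measurable_ident_circle_borel: "(\<lambda>z. z) \<in> borel_measurable circle_borel"
  unfolding circle_borel_def by (rule measurable_restrict_space1) simp

lemma cis_measurable_circle_borel: "cis \<in> measurable borel circle_borel"
  unfolding circle_borel_def
  by (rule measurable_restrict_space2) (auto intro!: borel_measurable_continuous_onI continuous_intros)

lemma sets_circle_haar [simp, measurable_cong]: "sets circle_haar = sets circle_borel"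
  by (simp add: circle_haar_def)

lemma space_circle_haar [simp]: "space circle_haar = sphere 0 1"
  by (simp add: circle_haar_def)

lemma measurable_ident_circle_haar [measurable]: "(\<lambda>z. z) \<in> borel_measurable circle_haar"
  using measurable_ident_circle_borel by (simp cong: measurable_cong_sets)

lemma prob_space_circle_haar: "prob_space circle_haar"
  unfolding circle_haar_def
proof (rule prob_space.prob_space_distr)
  show "prob_space (uniform_measure lborel {0..<2 * pi})"
    by (rule prob_space_uniform_measure) (use pi_gt_zero in \<open>auto simp: ennreal_eq_0_iff simp del: pi_gt_zero\<close>)
  show "cis \<in> measurable (uniform_measure lborel {0..<2 * pi}) circle_borel"
    using cis_measurable_circle_borel by (simp cong: measurable_cong_sets)
qed

interpretation circle_haar: prob_space circle_haar
  by (rule prob_space_circle_haar)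

lemma measure_circle_haar_sphere [simp]: "measure circle_haar (sphere 0 1) = 1"
  using circle_haar.prob_space by simp

lemma cnj_borel_measurable [measurable]:
  "f \<in> borel_measurable M \<Longrightarrow> (\<lambda>x. cnj (f x)) \<in> borel_measurable M"
  by (rule borel_measurable_continuous_on[where f = cnj]) (auto intro!: continuous_intros)

lemma integral_circle_haar:
  fixes g :: "complex \<Rightarrow> complex"
  assumes "g \<in> borel_measurable circle_haar"
  shows "(\<integral>z. g z \<partial>circle_haar) = (\<integral>t. indicator {0..2 * pi} t *\<^sub>R g (cis t) \<partial>lborel) / (2 * pi)"
proof -
  have cis [measurable]: "cis \<in> measurable borel circle_borel"
    by (rule cis_measurable_circle_borel)
  have g [measurable]: "g \<in> borel_measurable circle_borel"
    using assms by (simp cong: measurable_cong_sets)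
  have "(\<integral>z. g z \<partial>circle_haar) = (\<integral>t. g (cis t) \<partial>uniform_measure lborel {0..<2 * pi})"
    unfolding circle_haar_def by (rule integral_distr) measurable
  also have "uniform_measure lborel {0..<2 * pi}
      = density lborel (\<lambda>t. ennreal (indicator {0..<2 * pi} t / (2 * pi)))"
    unfolding uniform_measure_def
    by (rule density_cong)
       (auto simp: indicator_def divide_ennreal[symmetric] simp flip: ennreal_1)
  also have "(\<integral>t. g (cis t) \<partial>\<dots>) = (\<integral>t. (indicator {0..<2 * pi} t / (2 * pi)) *\<^sub>R g (cis t) \<partial>lborel)"
    by (rule integral_density) auto
  also have "\<dots> = (\<integral>t. (indicator {0..2 * pi} t *\<^sub>R g (cis t)) / (2 * pi) \<partial>lborel)"
  proof (rule integral_cong_AE)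
    show "AE t in lborel. (indicator {0..<2 * pi} t / (2 * pi)) *\<^sub>R g (cis t)
        = (indicator {0..2 * pi} t *\<^sub>R g (cis t)) / (2 * pi)"
      using AE_lborel_singleton[of "2 * pi"]
      by eventually_elim (auto simp: indicator_def scaleR_conv_of_real)
  qed auto
  finally show ?thesis by simp
qed

lemma integral_circle_haar_powi:
  "(\<integral>z. z powi n \<partial>circle_haar) = (if n = 0 then 1 else 0)"
proof (cases "n = 0")
  case True
  then show ?thesis by simp
next
  case False
  have "(\<integral>t. indicator {0..2 * pi} t *\<^sub>R cis (of_int n * t) \<partial>lborel)
      = cis (of_int n * (2 * pi)) / (\<i> * of_int n) - cis (of_int n * 0) / (\<i> * of_int n)"
  proof (rule integral_FTC_Icc)
    show "((\<lambda>t. cis (of_int n * t) / (\<i> * of_int n)) has_vector_derivative cis (of_int n * t))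
        (at t within {0..2 * pi})" for t
      unfolding cis_conv_exp using False
      by (auto intro!: derivative_eq_intros has_vector_derivative_real_field simp: field_simps)
  qed (auto intro!: continuous_intros)
  also have "\<dots> = 0"
    using cis_multiple_2pi[of "of_int n"] by (simp add: mult.commute)
  finally have "(\<integral>t. indicator {0..2 * pi} t *\<^sub>R cis (of_int n * t) \<partial>lborel) = 0" .
  moreover have "(\<lambda>z. z powi n) \<in> borel_measurable circle_haar"
    unfolding power_int_def by measurable
  ultimately show ?thesis
    using False by (simp add: integral_circle_haar cis_power_int)
qed

lemma
  fixes f g :: "'a \<Rightarrow> complex"
  assumes [measurable]: "f \<in> borel_measurable M" "g \<in> borel_measurable M"
    and f2: "integrable M (\<lambda>x. (cmod (f x))\<^sup>2)" and g2: "integrable M (\<lambda>x. (cmod (g x))\<^sup>2)"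
  shows integrable_mult_L2: "integrable M (\<lambda>x. f x * g x)"
    and Cauchy_Schwarz_integral_norm: "(cmod (\<integral>x. f x * g x \<partial>M))\<^sup>2
      \<le> (\<integral>x. (cmod (f x))\<^sup>2 \<partial>M) * (\<integral>x. (cmod (g x))\<^sup>2 \<partial>M)"
proof -
  show int: "integrable M (\<lambda>x. f x * g x)"
  proof (rule Bochner_Integration.integrable_bound)
    show "integrable M (\<lambda>x. (cmod (f x))\<^sup>2 + (cmod (g x))\<^sup>2)"
      using f2 g2 by simp
    have "a * b \<le> a\<^sup>2 + b\<^sup>2" for a b :: real
      using sum_squares_bound[of a b] zero_le_power2[of a] zero_le_power2[of b] by linarith
    then show "AE x in M. norm (f x * g x) \<le> norm ((cmod (f x))\<^sup>2 + (cmod (g x))\<^sup>2)"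
      by (auto simp: norm_mult)
  qed measurable
  have "ennreal ((\<integral>x. cmod (f x) * cmod (g x) \<partial>M)\<^sup>2)
      = (\<integral>\<^sup>+x. ennreal (cmod (f x)) * ennreal (cmod (g x)) \<partial>M)\<^sup>2"
    using integrable_norm[OF int]
    by (subst ennreal_power[symmetric])
       (auto simp: nn_integral_eq_integral norm_mult simp flip: ennreal_mult)
  also have "\<dots> \<le> (\<integral>\<^sup>+x. ennreal (cmod (f x)) ^ 2 \<partial>M) * (\<integral>\<^sup>+x. ennreal (cmod (g x)) ^ 2 \<partial>M)"
    by (rule Cauchy_Schwarz_nn_integral) measurable
  also have "\<dots> = ennreal ((\<integral>x. (cmod (f x))\<^sup>2 \<partial>M) * (\<integral>x. (cmod (g x))\<^sup>2 \<partial>M))"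
    using f2 g2 by (simp add: ennreal_power nn_integral_eq_integral ennreal_mult)
  finally have "(\<integral>x. cmod (f x) * cmod (g x) \<partial>M)\<^sup>2
      \<le> (\<integral>x. (cmod (f x))\<^sup>2 \<partial>M) * (\<integral>x. (cmod (g x))\<^sup>2 \<partial>M)"
    by (simp add: ennreal_le_iff)
  moreover have "cmod (\<integral>x. f x * g x \<partial>M) \<le> (\<integral>x. cmod (f x) * cmod (g x) \<partial>M)"
    using integral_norm_bound[of M "\<lambda>x. f x * g x"] by (simp add: norm_mult)
  ultimately show "(cmod (\<integral>x. f x * g x \<partial>M))\<^sup>2
      \<le> (\<integral>x. (cmod (f x))\<^sup>2 \<partial>M) * (\<integral>x. (cmod (g x))\<^sup>2 \<partial>M)"
    by (meson norm_ge_zero order_trans power_mono)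
qed

definition L2_sq :: "(complex \<Rightarrow> complex) \<Rightarrow> real" where
  "L2_sq f = (\<integral>z. (cmod (f z))\<^sup>2 \<partial>circle_haar)"

lemma L2_norm_circle_eq: "L2_norm_circle f = sqrt (L2_sq f)"
  by (simp add: L2_norm_circle_def weighted_L2_norm_def L2_sq_def)

lemma L2_sq_nonneg [simp]: "0 \<le> L2_sq f"
  by (simp add: L2_sq_def)

lemma L2_circle_measurable: "f \<in> L2_circle \<Longrightarrow> f \<in> borel_measurable circle_haar"
  by (simp add: L2_circle_def)

lemma L2_circle_integrable_sq: "f \<in> L2_circle \<Longrightarrow> integrable circle_haar (\<lambda>z. (cmod (f z))\<^sup>2)"
  by (simp add: L2_circle_def)

lemma L2_circle_mult_integrable:
  "f \<in> L2_circle \<Longrightarrow> g \<in> L2_circle \<Longrightarrow> integrable circle_haar (\<lambda>z. f z * g z)"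
  by (auto simp: L2_circle_def intro: integrable_mult_L2)

lemma L2_circle_mult_bound:
  "f \<in> L2_circle \<Longrightarrow> g \<in> L2_circle \<Longrightarrow> (cmod (\<integral>z. f z * g z \<partial>circle_haar))\<^sup>2 \<le> L2_sq f * L2_sq g"
  unfolding L2_sq_def by (auto simp: L2_circle_def intro: Cauchy_Schwarz_integral_norm)

lemma cmod_add_sq_le: "(cmod (a + b))\<^sup>2 \<le> 2 * (cmod a)\<^sup>2 + 2 * (cmod b)\<^sup>2"
proof -
  have "(cmod (a + b))\<^sup>2 \<le> (cmod a + cmod b)\<^sup>2"
    by (intro power_mono norm_triangle_ineq) simp
  also have "\<dots> \<le> 2 * (cmod a)\<^sup>2 + 2 * (cmod b)\<^sup>2"
    using sum_squares_bound[of "cmod a" "cmod b"] by (simp add: power2_sum)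
  finally show ?thesis .
qed

text \<open>
  Every closure property of \<open>L2_circle\<close> below is obtained by a pointwise domination on the
  circle. Norms are kept squared, and \<open>cmod_add_sq_le\<close> stands in for the triangle inequality: its
  factor \<open>2\<close> is harmless because only convergence to \<open>0\<close> matters.
\<close>

lemma L2_circle_dominated:
  assumes [measurable]: "f \<in> borel_measurable circle_haar"
    and int: "integrable circle_haar h"
    and le: "\<And>z. z \<in> sphere 0 1 \<Longrightarrow> (cmod (f z))\<^sup>2 \<le> h z"
  shows "f \<in> L2_circle" and "L2_sq f \<le> (\<integral>z. h z \<partial>circle_haar)"
proof -
  have "integrable circle_haar (\<lambda>z. (cmod (f z))\<^sup>2)"
  proof (rule Bochner_Integration.integrable_bound[OF int])
    show "AE z in circle_haar. norm ((cmod (f z))\<^sup>2) \<le> norm (h z)"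
      using le by (auto intro!: AE_I2 order_trans[OF le])
  qed measurable
  then show "f \<in> L2_circle" "L2_sq f \<le> (\<integral>z. h z \<partial>circle_haar)"
    using le int by (auto simp: L2_circle_def L2_sq_def intro!: integral_mono)
qed

lemma L2_circle_bounded:
  assumes "f \<in> borel_measurable circle_haar" and "\<And>z. z \<in> sphere 0 1 \<Longrightarrow> cmod (f z) \<le> B"
  shows "f \<in> L2_circle" and "L2_sq f \<le> B\<^sup>2"
  using L2_circle_dominated[OF assms(1), of "\<lambda>_. B\<^sup>2"] assms(2)
  by (auto simp: power_mono)

lemma L2_circle_add:
  assumes "f \<in> L2_circle" "g \<in> L2_circle"
  shows "(\<lambda>z. f z + g z) \<in> L2_circle" and "L2_sq (\<lambda>z. f z + g z) \<le> 2 * L2_sq f + 2 * L2_sq g"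
  using L2_circle_dominated[of "\<lambda>z. f z + g z" "\<lambda>z. 2 * (cmod (f z))\<^sup>2 + 2 * (cmod (g z))\<^sup>2"] assms
  by (auto simp: L2_circle_def L2_sq_def cmod_add_sq_le)

lemma L2_circle_mult_bounded:
  assumes "f \<in> L2_circle" "g \<in> borel_measurable circle_haar"
    and le: "\<And>z. z \<in> sphere 0 1 \<Longrightarrow> cmod (g z) \<le> B"
  shows "(\<lambda>z. g z * f z) \<in> L2_circle" and "L2_sq (\<lambda>z. g z * f z) \<le> B\<^sup>2 * L2_sq f"
proof -
  have "(cmod (g z * f z))\<^sup>2 \<le> B\<^sup>2 * (cmod (f z))\<^sup>2" if "z \<in> sphere 0 1" for z
    using le[OF that] by (auto simp: norm_mult power_mult_distrib intro!: mult_right_mono power_mono)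
  then show "(\<lambda>z. g z * f z) \<in> L2_circle" "L2_sq (\<lambda>z. g z * f z) \<le> B\<^sup>2 * L2_sq f"
    using L2_circle_dominated[of "\<lambda>z. g z * f z" "\<lambda>z. B\<^sup>2 * (cmod (f z))\<^sup>2"] assms
  by (auto simp: L2_circle_def L2_sq_def)
qed

lemma L2_circle_cmult: "f \<in> L2_circle \<Longrightarrow> (\<lambda>z. c * f z) \<in> L2_circle"
  using L2_circle_mult_bounded(1)[of f "\<lambda>_. c" "cmod c"] by simp

lemma L2_circle_cnj: "f \<in> L2_circle \<Longrightarrow> (\<lambda>z. cnj (f z)) \<in> L2_circle"
  by (auto simp: L2_circle_def)

lemma L2_circle_diff:
  assumes "f \<in> L2_circle" "g \<in> L2_circle"
  shows "(\<lambda>z. f z - g z) \<in> L2_circle" and "L2_sq (\<lambda>z. f z - g z) \<le> 2 * L2_sq f + 2 * L2_sq g"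
  using L2_circle_add[OF assms(1) L2_circle_cmult[OF assms(2), of "-1"]]
  by (simp_all add: L2_sq_def)

lemma L2_circle_sum: "(\<And>i. i \<in> I \<Longrightarrow> f i \<in> L2_circle) \<Longrightarrow> (\<lambda>z. \<Sum>i\<in>I. f i z) \<in> L2_circle"
proof (induction I rule: infinite_finite_induct)
  case (insert i I)
  then show ?case by (simp add: L2_circle_add(1))
qed (simp_all add: L2_circle_def)

lemma powi_L2_circle: "(\<lambda>z. z powi n) \<in> L2_circle"
  by (rule L2_circle_bounded(1)[where B = 1]) (auto simp: power_int_def norm_power norm_inverse)

lemma power_L2_circle: "(\<lambda>z. z ^ n) \<in> L2_circle"
  using powi_L2_circle[of "int n"] by simp

section \<open>The Hardy space as the closure of the analytic polynomials\<close>

lemma power_int_minus_circle: "cmod z = 1 \<Longrightarrow> z powi (- n) = cnj (z powi n)"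
proof -
  assume "cmod z = 1"
  then have "z powi n * cnj (z powi n) = 1"
    by (metis complex_norm_square norm_power_int of_real_1 power_int_1_left power_one)
  then show ?thesis
    by (simp add: power_int_minus inverse_unique)
qed

lemma L2_sq_powi [simp]: "L2_sq (\<lambda>z. z powi n) = 1"
proof -
  have "L2_sq (\<lambda>z. z powi n) = (\<integral>z. 1 \<partial>circle_haar)"
    unfolding L2_sq_def by (intro Bochner_Integration.integral_cong) (auto simp: norm_power_int)
  then show ?thesis by simp
qed

lemma fourier_coeff_add:
  "f \<in> L2_circle \<Longrightarrow> g \<in> L2_circle \<Longrightarrow>
    fourier_coeff (\<lambda>z. f z + g z) n = fourier_coeff f n + fourier_coeff g n"
  by (simp add: fourier_coeff_def distrib_right L2_circle_mult_integrable powi_L2_circle)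

lemma fourier_coeff_diff:
  "f \<in> L2_circle \<Longrightarrow> g \<in> L2_circle \<Longrightarrow>
    fourier_coeff (\<lambda>z. f z - g z) n = fourier_coeff f n - fourier_coeff g n"
  by (simp add: fourier_coeff_def left_diff_distrib L2_circle_mult_integrable powi_L2_circle)

lemma fourier_coeff_cmult: "fourier_coeff (\<lambda>z. c * f z) n = c * fourier_coeff f n"
  by (simp add: fourier_coeff_def mult.assoc)

lemma fourier_coeff_powi: "fourier_coeff (\<lambda>z. z powi m) n = (if m = n then 1 else 0)"
proof -
  have "fourier_coeff (\<lambda>z. z powi m) n = (\<integral>z. z powi (m - n) \<partial>circle_haar)"
    unfolding fourier_coeff_def
  proof (intro Bochner_Integration.integral_cong refl)
    fix z assume "z \<in> space circle_haar"
    then have "z \<noteq> 0" by auto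
    then show "z powi m * z powi (- n) = z powi (m - n)"
      by (simp flip: power_int_add)
  qed
  then show ?thesis by (simp add: integral_circle_haar_powi)
qed

lemma fourier_coeff_bound: "f \<in> L2_circle \<Longrightarrow> (cmod (fourier_coeff f n))\<^sup>2 \<le> L2_sq f"
  using L2_circle_mult_bound[of f "\<lambda>z. z powi (- n)"] by (simp add: fourier_coeff_def powi_L2_circle)

lemma poly_L2_circle: "(\<lambda>z. \<Sum>n<N. a n * z ^ n) \<in> L2_circle"
  by (intro L2_circle_sum L2_circle_cmult power_L2_circle)

lemma fourier_coeff_poly:
  "fourier_coeff (\<lambda>z. \<Sum>n<N. a n * z ^ n) m = (if 0 \<le> m \<and> m < int N then a (nat m) else 0)"
proof (induction N)
  case 0
  then show ?case by (auto simp: fourier_coeff_def)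
next
  case (Suc N)
  have "fourier_coeff (\<lambda>z. z ^ N) m = (if int N = m then 1 else 0)"
    using fourier_coeff_powi[of "int N" m] by simp
  then have "fourier_coeff (\<lambda>z. \<Sum>n<Suc N. a n * z ^ n) m
      = (if 0 \<le> m \<and> m < int N then a (nat m) else 0) + a N * (if int N = m then 1 else 0)"
    by (simp add: fourier_coeff_add poly_L2_circle L2_circle_cmult power_L2_circle
        fourier_coeff_cmult Suc)
  then show ?case by auto
qed

lemma L2_sq_diff_monomial:
  assumes u: "u \<in> L2_circle"
  shows "L2_sq (\<lambda>z. u z - a * z ^ n)
      = L2_sq u - (cmod (fourier_coeff u (int n)))\<^sup>2 + (cmod (a - fourier_coeff u (int n)))\<^sup>2"
proof -
  define c where "c = fourier_coeff u (int n)"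
  have expand: "(cmod (x - y))\<^sup>2 = (cmod x)\<^sup>2 - 2 * Re (cnj y * x) + (cmod y)\<^sup>2" for x y
    unfolding cmod_power2 by (simp add: power2_eq_square algebra_simps)
  have int: "integrable circle_haar (\<lambda>z. cnj a * (u z * z powi (- int n)))"
    using u by (simp add: L2_circle_mult_integrable powi_L2_circle)
  have "L2_sq (\<lambda>z. u z - a * z ^ n)
      = (\<integral>z. (cmod (u z))\<^sup>2 - 2 * Re (cnj a * (u z * z powi (- int n))) + (cmod a)\<^sup>2 \<partial>circle_haar)"
    unfolding L2_sq_def
  proof (intro Bochner_Integration.integral_cong refl)
    fix z assume "z \<in> space circle_haar"
    then have z: "cmod z = 1" by simp
    show "(cmod (u z - a * z ^ n))\<^sup>2
        = (cmod (u z))\<^sup>2 - 2 * Re (cnj a * (u z * z powi (- int n))) + (cmod a)\<^sup>2"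
      using z by (subst expand, subst power_int_minus_circle) (simp_all add: norm_mult norm_power mult_ac)
  qed
  also have "\<dots> = L2_sq u - 2 * Re (cnj a * c) + (cmod a)\<^sup>2"
  proof -
    define g where "g = (\<lambda>z. cnj a * (u z * z powi (- int n)))"
    have "(\<integral>z. g z \<partial>circle_haar) = cnj a * c" "integrable circle_haar g"
      using int by (simp_all add: g_def c_def fourier_coeff_def)
    moreover have "(\<integral>z. (cmod (u z))\<^sup>2 - 2 * Re (g z) + (cmod a)\<^sup>2 \<partial>circle_haar)
        = L2_sq u - 2 * Re (\<integral>z. g z \<partial>circle_haar) + (cmod a)\<^sup>2"
      using L2_circle_integrable_sq[OF u] \<open>integrable circle_haar g\<close> by (simp add: L2_sq_def)
    ultimately show ?thesis by (simp only: g_def)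
  qed
  also have "\<dots> = L2_sq u - (cmod c)\<^sup>2 + (cmod (a - c))\<^sup>2"
    by (subst expand) (simp add: algebra_simps)
  finally show ?thesis by (simp add: c_def)
qed

text \<open>
  Orthonormality of the powers. One identity contains both Bessel's inequality and the fact that the
  Fourier partial sum is the best approximation of given degree.
\<close>

lemma L2_sq_diff_poly:
  assumes u: "u \<in> L2_circle"
  shows "L2_sq (\<lambda>z. u z - (\<Sum>n<N. a n * z ^ n))
      = L2_sq u - (\<Sum>n<N. (cmod (fourier_coeff u (int n)))\<^sup>2)
        + (\<Sum>n<N. (cmod (a n - fourier_coeff u (int n)))\<^sup>2)"
proof (induction N)
  case (Suc N)
  let ?v = "\<lambda>z. u z - (\<Sum>n<N. a n * z ^ n)"
  have v: "?v \<in> L2_circle"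
    using u by (intro L2_circle_diff(1) poly_L2_circle)
  have "fourier_coeff ?v (int N) = fourier_coeff u (int N)"
    using u by (simp add: fourier_coeff_diff poly_L2_circle fourier_coeff_poly)
  then show ?case
    using L2_sq_diff_monomial[OF v, of "a N" N] Suc by (simp add: algebra_simps)
qed simp

lemma H2_L2_circle: "f \<in> H2 \<Longrightarrow> f \<in> L2_circle"
  by (simp add: H2_def)

text \<open>
  Arbitrary approximating polynomials, with no relation between those of different degrees,
  suffice for membership in \<open>H2\<close>: the Fourier partial sums do at least as well. This is the form
  in which closedness of \<open>H2\<close> becomes evident.
\<close>

lemma H2_iff_approx:
  "f \<in> H2 \<longleftrightarrow> f \<in> L2_circle \<and> (\<forall>e>0. \<exists>N a. L2_sq (\<lambda>z. f z - (\<Sum>n<N. a n * z ^ n)) < e)"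
    (is "_ \<longleftrightarrow> _ \<and> ?approx")
proof safe
  fix e :: real assume "f \<in> H2" "0 < e"
  then obtain a where "(\<lambda>N. L2_norm_circle (\<lambda>z. f z - (\<Sum>n<N. a n * z ^ n))) \<longlonglongrightarrow> 0"
    by (auto simp: H2_def)
  then have "(\<lambda>N. (L2_norm_circle (\<lambda>z. f z - (\<Sum>n<N. a n * z ^ n)))\<^sup>2) \<longlonglongrightarrow> 0"
    using tendsto_power[of _ 0 _ 2] by fastforce
  then have "(\<lambda>N. L2_sq (\<lambda>z. f z - (\<Sum>n<N. a n * z ^ n))) \<longlonglongrightarrow> 0"
    by (simp add: L2_norm_circle_eq)
  from order_tendstoD(2)[OF this \<open>0 < e\<close>] obtain N where "L2_sq (\<lambda>z. f z - (\<Sum>n<N. a n * z ^ n)) < e"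
    by (auto simp: eventually_sequentially)
  then show "\<exists>N a. L2_sq (\<lambda>z. f z - (\<Sum>n<N. a n * z ^ n)) < e"
    by blast
next
  assume f: "f \<in> L2_circle" and approx: ?approx
  define c where "c = (\<lambda>n. fourier_coeff f (int n))"
  have partial: "L2_sq (\<lambda>z. f z - (\<Sum>n<N. c n * z ^ n)) = L2_sq f - (\<Sum>n<N. (cmod (c n))\<^sup>2)" for N
    using L2_sq_diff_poly[OF f, where N = N and a = c] by (simp add: c_def)
  have "summable (\<lambda>n. (cmod (c n))\<^sup>2)"
  proof (rule summableI_nonneg_bounded)
    show "(\<Sum>n<N. (cmod (c n))\<^sup>2) \<le> L2_sq f" for N
      using L2_sq_nonneg[of "\<lambda>z. f z - (\<Sum>n<N. c n * z ^ n)"] by (simp only: partial)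
  qed simp
  moreover have "(\<lambda>N. L2_sq (\<lambda>z. f z - (\<Sum>n<N. c n * z ^ n))) \<longlonglongrightarrow> 0"
  proof (rule order_tendstoI)
    fix e :: real assume "0 < e"
    then obtain M a where M: "L2_sq (\<lambda>z. f z - (\<Sum>n<M. a n * z ^ n)) < e"
      using approx by blast
    have "L2_sq (\<lambda>z. f z - (\<Sum>n<N. c n * z ^ n)) < e" if "M \<le> N" for N
    proof -
      \<comment> \<open>Fourier partial sums are the best approximations, and they improve with the degree.\<close>
      have "L2_sq f - (\<Sum>n<N. (cmod (c n))\<^sup>2) \<le> L2_sq f - (\<Sum>n<M. (cmod (c n))\<^sup>2)"
        using that by (intro diff_left_mono sum_mono2) auto
      also have "\<dots> \<le> L2_sq (\<lambda>z. f z - (\<Sum>n<M. a n * z ^ n))"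
        unfolding L2_sq_diff_poly[OF f] by (simp add: c_def sum_nonneg)
      finally show ?thesis using M by (simp only: partial)
    qed
    then show "\<forall>\<^sub>F N in sequentially. L2_sq (\<lambda>z. f z - (\<Sum>n<N. c n * z ^ n)) < e"
      by (auto simp: eventually_sequentially)
  qed (auto intro!: always_eventually intro: less_le_trans[OF _ L2_sq_nonneg])
  then have "(\<lambda>N. L2_norm_circle (\<lambda>z. f z - (\<Sum>n<N. c n * z ^ n))) \<longlonglongrightarrow> 0"
    unfolding L2_norm_circle_eq using tendsto_real_sqrt by fastforce
  ultimately show "f \<in> H2"
    using f by (auto simp: H2_def)
qed (simp add: H2_L2_circle)

lemma H2_fourier_approx:
  assumes f: "f \<in> H2" and e: "0 < e"
  obtains N where "L2_sq (\<lambda>z. f z - (\<Sum>n<N. fourier_coeff f (int n) * z ^ n)) < e"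
proof -
  obtain N a where "L2_sq (\<lambda>z. f z - (\<Sum>n<N. a n * z ^ n)) < e"
    using assms H2_iff_approx by blast
  moreover have "L2_sq (\<lambda>z. f z - (\<Sum>n<N. fourier_coeff f (int n) * z ^ n))
      \<le> L2_sq (\<lambda>z. f z - (\<Sum>n<N. a n * z ^ n))"
    unfolding L2_sq_diff_poly[OF H2_L2_circle[OF f]] by (simp add: sum_nonneg)
  ultimately show thesis by (intro that[of N]) (rule le_less_trans)
qed

lemma H2_closed:
  assumes u: "u \<in> L2_circle" and approx: "\<And>e. 0 < e \<Longrightarrow> \<exists>v\<in>H2. L2_sq (\<lambda>z. u z - v z) < e"
  shows "u \<in> H2"
  unfolding H2_iff_approx
proof (intro conjI allI impI u)
  fix e :: real assume e: "0 < e"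
  obtain v where v: "v \<in> H2" "L2_sq (\<lambda>z. u z - v z) < e / 4"
    using approx[of "e / 4"] e by auto
  obtain N a where p: "L2_sq (\<lambda>z. v z - (\<Sum>n<N. a n * z ^ n)) < e / 4"
    using v(1) e unfolding H2_iff_approx by (metis zero_less_divide_iff zero_less_numeral)
  have "L2_sq (\<lambda>z. u z - (\<Sum>n<N. a n * z ^ n))
      = L2_sq (\<lambda>z. (u z - v z) + (v z - (\<Sum>n<N. a n * z ^ n)))"
    by simp
  also have "\<dots> \<le> 2 * L2_sq (\<lambda>z. u z - v z) + 2 * L2_sq (\<lambda>z. v z - (\<Sum>n<N. a n * z ^ n))"
    using u v(1) by (intro L2_circle_add(2) L2_circle_diff(1) poly_L2_circle) (auto dest: H2_L2_circle)
  also have "\<dots> < e"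
    using v p by simp
  finally show "\<exists>N a. L2_sq (\<lambda>z. u z - (\<Sum>n<N. a n * z ^ n)) < e"
    by (intro exI)
qed

lemma H2_0_H2: "f \<in> H2_0 \<Longrightarrow> f \<in> H2"
  by (simp add: H2_0_def)

text \<open>
  The zeroth Fourier coefficient is continuous in the \<open>L\<^sup>2\<close> norm.
\<close>

lemma H2_0_closed:
  assumes u: "u \<in> L2_circle" and approx: "\<And>e. 0 < e \<Longrightarrow> \<exists>v\<in>H2_0. L2_sq (\<lambda>z. u z - v z) < e"
  shows "u \<in> H2_0"
proof -
  have "u \<in> H2"
    using approx by (intro H2_closed u) (auto dest: H2_0_H2)
  moreover have "(cmod (fourier_coeff u 0))\<^sup>2 \<le> 0"
  proof (rule field_le_epsilon)
    fix e :: real assume "0 < e"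
    then obtain v where v: "v \<in> H2_0" "L2_sq (\<lambda>z. u z - v z) < e"
      using approx by blast
    then have vL: "v \<in> L2_circle" and v0: "fourier_coeff v 0 = 0"
      by (auto simp: H2_0_def H2_L2_circle)
    have "(cmod (fourier_coeff (\<lambda>z. u z - v z) 0))\<^sup>2 \<le> L2_sq (\<lambda>z. u z - v z)"
      using u vL by (intro fourier_coeff_bound L2_circle_diff)
    then show "(cmod (fourier_coeff u 0))\<^sup>2 \<le> 0 + e"
      using u vL v0 v(2) by (simp add: fourier_coeff_diff)
  qed
  ultimately show ?thesis by (simp add: H2_0_def)
qed

lemma H2_poly: "(\<lambda>z. \<Sum>n<N. a n * z ^ n) \<in> H2"
  unfolding H2_iff_approx
proof (intro conjI allI impI poly_L2_circle)
  fix e :: real assume "0 < e"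
  then have "L2_sq (\<lambda>z. (\<Sum>n<N. a n * z ^ n) - (\<Sum>n<N. a n * z ^ n)) < e"
    by (simp add: L2_sq_def)
  then show "\<exists>M b. L2_sq (\<lambda>z. (\<Sum>n<N. a n * z ^ n) - (\<Sum>n<M. b n * z ^ n)) < e" by blast
qed

lemma H2_add:
  assumes f: "f \<in> H2" and g: "g \<in> H2"
  shows "(\<lambda>z. f z + g z) \<in> H2"
proof (rule H2_closed)
  show "(\<lambda>z. f z + g z) \<in> L2_circle"
    using f g by (intro L2_circle_add) (auto dest: H2_L2_circle)
next
  fix e :: real assume "0 < e"
  then have e: "0 < e / 4" by simp
  obtain N where N: "L2_sq (\<lambda>z. f z - (\<Sum>n<N. fourier_coeff f (int n) * z ^ n)) < e / 4"
    using H2_fourier_approx[OF f e] by blast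
  obtain M where M: "L2_sq (\<lambda>z. g z - (\<Sum>n<M. fourier_coeff g (int n) * z ^ n)) < e / 4"
    using H2_fourier_approx[OF g e] by blast
  define p where "p = (\<lambda>z. \<Sum>n<N. fourier_coeff f (int n) * z ^ n)"
  define q where "q = (\<lambda>z. \<Sum>n<M. fourier_coeff g (int n) * z ^ n)"
  have pq: "p z + q z = (\<Sum>n<max N M. ((if n < N then fourier_coeff f (int n) else 0)
      + (if n < M then fourier_coeff g (int n) else 0)) * z ^ n)" for z
    unfolding p_def q_def distrib_right sum.distrib
    by (intro arg_cong2[where f = "(+)"] sum.mono_neutral_cong_left) auto
  have "L2_sq (\<lambda>z. (f z + g z) - (p z + q z)) = L2_sq (\<lambda>z. (f z - p z) + (g z - q z))"
    by (simp add: algebra_simps)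
  also have "\<dots> \<le> 2 * L2_sq (\<lambda>z. f z - p z) + 2 * L2_sq (\<lambda>z. g z - q z)"
    using f g unfolding p_def q_def
    by (intro L2_circle_add(2) L2_circle_diff(1) poly_L2_circle) (auto dest: H2_L2_circle)
  also have "\<dots> < e"
    using N M by (simp add: p_def q_def)
  finally have "L2_sq (\<lambda>z. (f z + g z) - (p z + q z)) < e" .
  then show "\<exists>v\<in>H2. L2_sq (\<lambda>z. f z + g z - v z) < e"
    unfolding pq by (rule bexI[OF _ H2_poly])
qed

lemma H2_cmult:
  assumes f: "f \<in> H2"
  shows "(\<lambda>z. c * f z) \<in> H2"
proof (rule H2_closed)
  show "(\<lambda>z. c * f z) \<in> L2_circle"
    using f by (intro L2_circle_cmult H2_L2_circle)
next
  fix e :: real assume e: "0 < e"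
  define K where "K = (cmod c)\<^sup>2 + 1"
  have K: "0 < K" by (simp add: K_def add_nonneg_pos)
  obtain N where N: "L2_sq (\<lambda>z. f z - (\<Sum>n<N. fourier_coeff f (int n) * z ^ n)) < e / K"
    using H2_fourier_approx[OF f, of "e / K"] e K by auto
  have "L2_sq (\<lambda>z. c * (f z - (\<Sum>n<N. fourier_coeff f (int n) * z ^ n)))
      \<le> (cmod c)\<^sup>2 * L2_sq (\<lambda>z. f z - (\<Sum>n<N. fourier_coeff f (int n) * z ^ n))"
    using f by (intro L2_circle_mult_bounded(2) L2_circle_diff poly_L2_circle) (auto dest: H2_L2_circle)
  also have "\<dots> \<le> K * L2_sq (\<lambda>z. f z - (\<Sum>n<N. fourier_coeff f (int n) * z ^ n))"
    by (intro mult_right_mono) (auto simp: K_def)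
  also have "\<dots> < e"
    using N K by (simp add: field_simps)
  finally have "L2_sq (\<lambda>z. c * f z - (\<Sum>n<N. (c * fourier_coeff f (int n)) * z ^ n)) < e"
    by (simp add: right_diff_distrib sum_distrib_left mult.assoc)
  then show "\<exists>v\<in>H2. L2_sq (\<lambda>z. c * f z - v z) < e"
    by (rule bexI[OF _ H2_poly])
qed

lemma H2_diff: "f \<in> H2 \<Longrightarrow> g \<in> H2 \<Longrightarrow> (\<lambda>z. f z - g z) \<in> H2"
  using H2_add[of f "\<lambda>z. -1 * g z"] H2_cmult[of g "-1"] by simp

lemma H2_0_add: "f \<in> H2_0 \<Longrightarrow> g \<in> H2_0 \<Longrightarrow> (\<lambda>z. f z + g z) \<in> H2_0"
  by (auto simp: H2_0_def H2_add fourier_coeff_add H2_L2_circle)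

lemma H2_0_cmult: "f \<in> H2_0 \<Longrightarrow> (\<lambda>z. c * f z) \<in> H2_0"
  by (auto simp: H2_0_def H2_cmult fourier_coeff_cmult)

lemma zero_H2_0: "(\<lambda>z. 0) \<in> H2_0"
  using H2_poly[where N = 0] by (simp add: H2_0_def fourier_coeff_def)

lemma H2_0_sum: "(\<And>i. i \<in> I \<Longrightarrow> f i \<in> H2_0) \<Longrightarrow> (\<lambda>z. \<Sum>i\<in>I. f i z) \<in> H2_0"
  by (induction I rule: infinite_finite_induct) (auto simp: H2_0_add zero_H2_0)

lemma H2_0_cong:
  assumes "u \<in> H2_0" and eq: "\<And>z. z \<in> sphere 0 1 \<Longrightarrow> u z = v z"
  shows "v \<in> H2_0"
proof (rule H2_0_closed)
  have "u \<in> L2_circle"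
    using assms(1) by (intro H2_L2_circle H2_0_H2)
  then show "v \<in> L2_circle"
    using eq measurable_cong[of circle_haar u v borel]
      Bochner_Integration.integrable_cong[of circle_haar circle_haar
        "\<lambda>z. (cmod (u z))\<^sup>2" "\<lambda>z. (cmod (v z))\<^sup>2"]
    by (simp add: L2_circle_def)
  have "L2_sq (\<lambda>z. v z - u z) = (\<integral>z. 0 \<partial>circle_haar)"
    unfolding L2_sq_def using eq by (intro Bochner_Integration.integral_cong) auto
  then show "\<exists>w\<in>H2_0. L2_sq (\<lambda>z. v z - w z) < e" if "0 < e" for e
    using assms(1) that by (intro bexI[of _ u]) simp_all
qed

lemma H2_0_monomial: "0 < n \<Longrightarrow> (\<lambda>z. z ^ n) \<in> H2_0"
  using H2_poly[where N = "Suc n" and a = "\<lambda>k. if k = n then 1 else 0"]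
    fourier_coeff_powi[of "int n" 0]
  by (simp add: H2_0_def if_distrib[of "\<lambda>c. c * _"] cong: if_cong)

lemma H2_0_shift:
  assumes f: "f \<in> H2" and k: "0 < k"
  shows "(\<lambda>z. z ^ k * f z) \<in> H2_0"
proof (rule H2_0_closed)
  have bounded: "(\<lambda>z. z ^ k) \<in> borel_measurable circle_haar"
    "\<And>z. z \<in> sphere 0 1 \<Longrightarrow> cmod (z ^ k) \<le> 1"
    by (auto simp: norm_power)
  show "(\<lambda>z. z ^ k * f z) \<in> L2_circle"
    using L2_circle_mult_bounded(1)[OF H2_L2_circle[OF f] bounded] .
  fix e :: real assume "0 < e"
  then obtain N where N: "L2_sq (\<lambda>z. f z - (\<Sum>n<N. fourier_coeff f (int n) * z ^ n)) < e"
    using H2_fourier_approx[OF f] by blast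
  have "L2_sq (\<lambda>z. z ^ k * (f z - (\<Sum>n<N. fourier_coeff f (int n) * z ^ n)))
      \<le> 1\<^sup>2 * L2_sq (\<lambda>z. f z - (\<Sum>n<N. fourier_coeff f (int n) * z ^ n))"
    using f by (intro L2_circle_mult_bounded(2)[OF _ bounded] L2_circle_diff poly_L2_circle H2_L2_circle)
  then have "L2_sq (\<lambda>z. z ^ k * f z - (\<Sum>n<N. fourier_coeff f (int n) * z ^ (k + n))) < e"
    using N by (simp add: right_diff_distrib sum_distrib_left power_add mult_ac)
  moreover have "(\<lambda>z. \<Sum>n<N. fourier_coeff f (int n) * z ^ (k + n)) \<in> H2_0"
    using k by (intro H2_0_sum H2_0_cmult H2_0_monomial) simp
  ultimately show "\<exists>v\<in>H2_0. L2_sq (\<lambda>z. z ^ k * f z - v z) < e" by (rule bexI)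
qed

lemma fourier_coeff_H2_neg:
  assumes f: "f \<in> H2" and n: "n < 0"
  shows "fourier_coeff f n = 0"
proof -
  have fL: "f \<in> L2_circle" using f by (rule H2_L2_circle)
  have "(cmod (fourier_coeff f n))\<^sup>2 \<le> 0"
  proof (rule field_le_epsilon)
    fix e :: real assume "0 < e"
    then obtain N where N: "L2_sq (\<lambda>z. f z - (\<Sum>n<N. fourier_coeff f (int n) * z ^ n)) < e"
      using H2_fourier_approx[OF f] by blast
    have "(cmod (fourier_coeff (\<lambda>z. f z - (\<Sum>n<N. fourier_coeff f (int n) * z ^ n)) n))\<^sup>2
        \<le> L2_sq (\<lambda>z. f z - (\<Sum>n<N. fourier_coeff f (int n) * z ^ n))"
      using fL by (intro fourier_coeff_bound L2_circle_diff poly_L2_circle)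
    then show "(cmod (fourier_coeff f n))\<^sup>2 \<le> 0 + e"
      using fL N n by (simp add: fourier_coeff_diff fourier_coeff_poly poly_L2_circle)
  qed
  then show ?thesis by simp
qed

text \<open>
  All the orthogonality relations between \<open>H2\<close>, \<open>H2_0\<close> and \<open>H2_minus\<close> used later are
  conjugated forms of this one: the product of the two functions has only positive frequencies.
\<close>

lemma integral_H2_0_mult_H2:
  assumes u: "u \<in> H2_0" and h: "h \<in> H2"
  shows "(\<integral>z. u z * h z \<partial>circle_haar) = 0"
proof -
  have uL: "u \<in> L2_circle" and hL: "h \<in> L2_circle"
    using u h by (auto dest: H2_0_H2 H2_L2_circle)
  have coeff: "(\<integral>z. u z * z ^ n \<partial>circle_haar) = 0" for n
    using u fourier_coeff_H2_neg[of u "- int n"] by (cases "n = 0") (auto simp: H2_0_def fourier_coeff_def)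
  have "(cmod (\<integral>z. u z * h z \<partial>circle_haar))\<^sup>2 \<le> 0"
  proof (rule field_le_epsilon)
    fix e :: real assume e: "0 < e"
    define K where "K = L2_sq u + 1"
    have K: "0 < K" by (simp add: K_def add_nonneg_pos)
    obtain N where N: "L2_sq (\<lambda>z. h z - (\<Sum>n<N. fourier_coeff h (int n) * z ^ n)) < e / K"
      using H2_fourier_approx[OF h, of "e / K"] e K by auto
    let ?p = "\<lambda>z. \<Sum>n<N. fourier_coeff h (int n) * z ^ n"
    have "(\<integral>z. u z * ?p z \<partial>circle_haar)
        = (\<Sum>n<N. fourier_coeff h (int n) * (\<integral>z. u z * z ^ n \<partial>circle_haar))"
      using L2_circle_mult_integrable[OF uL power_L2_circle]
      by (simp add: sum_distrib_left mult.left_commute[of "u _"])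
    then have "(\<integral>z. u z * h z \<partial>circle_haar) = (\<integral>z. u z * (h z - ?p z) \<partial>circle_haar)"
      using uL hL by (simp add: coeff right_diff_distrib L2_circle_mult_integrable poly_L2_circle)
    then have "(cmod (\<integral>z. u z * h z \<partial>circle_haar))\<^sup>2 \<le> L2_sq u * L2_sq (\<lambda>z. h z - ?p z)"
      using uL hL by (auto intro!: L2_circle_mult_bound L2_circle_diff poly_L2_circle)
    also have "\<dots> \<le> K * (e / K)"
      using N by (intro mult_mono) (auto simp: K_def add_nonneg_nonneg)
    finally show "(cmod (\<integral>z. u z * h z \<partial>circle_haar))\<^sup>2 \<le> 0 + e"
      using K by simp
  qed
  then show ?thesis by simp
qed

section \<open>Cauchy transforms and the Poisson integral\<close>

text \<open>
  On the circle \<open>1 / (1 - r * z * cnj w)\<close> is the reproducing kernel of \<open>H2\<close> at \<open>r * w\<close>.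
  Integrated in \<open>w\<close> against \<open>\<mu>\<close> it produces the Hankel operator, and against Haar measure it
  evaluates \<open>H2\<close> functions inside the disc; hence the measure is a parameter.
\<close>

definition cauchy_transform :: "complex measure \<Rightarrow> real \<Rightarrow> (complex \<Rightarrow> complex) \<Rightarrow> complex \<Rightarrow> complex" where
  "cauchy_transform N r h z = (\<integral>w. h w / (1 - of_real r * z * cnj w) \<partial>N)"

locale circle_measure = finite_measure N for N :: "complex measure" +
  fixes r :: real
  assumes sets_N [measurable_cong]: "sets N = sets circle_borel"
    and r_nonneg: "0 \<le> r" and r_less_1: "r < 1"
begin

lemma space_N [simp]: "space N = sphere 0 1"
  using sets_eq_imp_space_eq[OF sets_N] by simp

lemma measurable_ident_N [measurable]: "(\<lambda>z. z) \<in> borel_measurable N"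
  using measurable_ident_circle_borel sets_N by (simp cong: measurable_cong_sets)

lemma cauchy_kernel_bound:
  assumes "cmod z = 1" "cmod w = 1"
  shows "1 - r \<le> cmod (1 - of_real r * z * cnj w)"
  using norm_triangle_ineq2[of 1 "of_real r * z * cnj w"] r_nonneg assms by (simp add: norm_mult)

lemma cauchy_kernel_nonzero:
  assumes "cmod z = 1" "cmod w = 1"
  shows "1 - of_real r * z * cnj w \<noteq> 0"
  using cauchy_kernel_bound[OF assms] r_less_1 by auto

lemma integrable_mult_bounded:
  fixes h g :: "complex \<Rightarrow> complex"
  assumes h: "integrable N h" and [measurable]: "g \<in> borel_measurable N"
    and B: "\<And>w. cmod w = 1 \<Longrightarrow> cmod (g w) \<le> B"
  shows "integrable N (\<lambda>w. h w * g w)"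
proof (rule Bochner_Integration.integrable_bound)
  show "integrable N (\<lambda>w. cmod (h w) * B)" using h by auto
  show "(\<lambda>w. h w * g w) \<in> borel_measurable N" using h by measurable
  have "cmod (h w) * cmod (g w) \<le> \<bar>cmod (h w) * B\<bar>" if "cmod w = 1" for w
    using B[OF that] by (smt (verit) mult_left_mono norm_ge_zero)
  then show "AE w in N. norm (h w * g w) \<le> norm (cmod (h w) * B)"
    by (auto simp: norm_mult)
qed

lemma integrable_bounded:
  fixes g :: "complex \<Rightarrow> complex"
  assumes "g \<in> borel_measurable N" "\<And>w. cmod w = 1 \<Longrightarrow> cmod (g w) \<le> B"
  shows "integrable N g"
  using integrable_mult_bounded[of "\<lambda>_. 1" g B] assms by simp

lemma integrable_cauchy_kernel:
  assumes h: "integrable N h" and z: "cmod z = 1"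
  shows "integrable N (\<lambda>w. h w / (1 - of_real r * z * cnj w))"
proof -
  have "integrable N (\<lambda>w. h w * (1 / (1 - of_real r * z * cnj w)))"
  proof (rule integrable_mult_bounded[OF h])
    show "cmod (1 / (1 - of_real r * z * cnj w)) \<le> 1 / (1 - r)" if "cmod w = 1" for w
      using cauchy_kernel_bound[OF z that] r_less_1 by (simp add: norm_divide frac_le)
  qed measurable
  then show ?thesis by simp
qed

lemma integrable_mult_cnj_power: "integrable N h \<Longrightarrow> integrable N (\<lambda>w. h w * cnj w ^ n)"
  by (rule integrable_mult_bounded[where B = 1]) (auto simp: norm_power)

text \<open>
  The kernel is a geometric series with ratio of modulus \<open>r\<close>, so the transform is a uniform limit
  of polynomials. Measurability, boundedness and membership in \<open>H2\<close> all follow from this rate.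
\<close>

lemma cauchy_transform_partial_sum:
  assumes h: "integrable N h" and z: "cmod z = 1"
  shows "cmod (cauchy_transform N r h z - (\<Sum>n<k. (\<integral>w. h w * cnj w ^ n \<partial>N) * of_real r ^ n * z ^ n))
      \<le> r ^ k / (1 - r) * (\<integral>w. cmod (h w) \<partial>N)"
proof -
  let ?x = "\<lambda>w. of_real r * z * cnj w"
  have geometric: "h w / (1 - ?x w) - (\<Sum>n<k. (h w * cnj w ^ n) * (of_real r ^ n * z ^ n))
      = h w * ?x w ^ k / (1 - ?x w)" if "cmod w = 1" for w
  proof -
    have nz: "1 - ?x w \<noteq> 0" by (rule cauchy_kernel_nonzero[OF z that])
    have "(\<Sum>n<k. (h w * cnj w ^ n) * (of_real r ^ n * z ^ n)) = h w * (\<Sum>n<k. ?x w ^ n)"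
      by (simp add: sum_distrib_left power_mult_distrib mult_ac)
    also have "\<dots> = h w * ((1 - ?x w ^ k) / (1 - ?x w))"
      using nz by (subst sum_gp_strict) auto
    finally show ?thesis by (simp only: ) (simp add: diff_divide_distrib[symmetric] algebra_simps)
  qed
  have int1: "integrable N (\<lambda>w. h w / (1 - ?x w))"
    by (rule integrable_cauchy_kernel[OF h z])
  have int2: "integrable N (\<lambda>w. \<Sum>n<k. (h w * cnj w ^ n) * (of_real r ^ n * z ^ n))"
    using integrable_mult_cnj_power[OF h] by auto
  have "cauchy_transform N r h z - (\<Sum>n<k. (\<integral>w. h w * cnj w ^ n \<partial>N) * of_real r ^ n * z ^ n)
      = (\<integral>w. h w / (1 - ?x w) - (\<Sum>n<k. (h w * cnj w ^ n) * (of_real r ^ n * z ^ n)) \<partial>N)"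
  proof -
    have "(\<integral>w. (\<Sum>n<k. (h w * cnj w ^ n) * (of_real r ^ n * z ^ n)) \<partial>N)
        = (\<Sum>n<k. (\<integral>w. h w * cnj w ^ n \<partial>N) * (of_real r ^ n * z ^ n))"
      using integrable_mult_cnj_power[OF h] by (subst Bochner_Integration.integral_sum) auto
    then show ?thesis
      by (subst Bochner_Integration.integral_diff[OF int1 int2]) (simp add: cauchy_transform_def mult.assoc)
  qed
  also have "cmod \<dots> \<le> (\<integral>w. r ^ k / (1 - r) * cmod (h w) \<partial>N)"
  proof (rule Bochner_Integration.integral_norm_bound_integral)
    fix w assume "w \<in> space N"
    then have w: "cmod w = 1" by simp
    have "cmod (h w * ?x w ^ k / (1 - ?x w)) = cmod (h w) * r ^ k / cmod (1 - ?x w)"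
      using z w r_nonneg by (simp add: norm_mult norm_divide norm_power)
    also have "\<dots> \<le> cmod (h w) * r ^ k / (1 - r)"
      using cauchy_kernel_bound[OF z w] r_nonneg r_less_1 by (intro frac_le) auto
    finally show "cmod (h w / (1 - ?x w) - (\<Sum>n<k. (h w * cnj w ^ n) * (of_real r ^ n * z ^ n)))
        \<le> r ^ k / (1 - r) * cmod (h w)"
      unfolding geometric[OF w] by (simp add: mult.commute)
  qed (use int1 int2 h in auto)
  finally show ?thesis by simp
qed

lemma cauchy_transform_LIMSEQ:
  assumes h: "integrable N h" and z: "cmod z = 1"
  shows "(\<lambda>k. \<Sum>n<k. (\<integral>w. h w * cnj w ^ n \<partial>N) * of_real r ^ n * z ^ n)
      \<longlonglongrightarrow> cauchy_transform N r h z"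
proof -
  have "(\<lambda>k. r ^ k / (1 - r) * (\<integral>w. cmod (h w) \<partial>N)) \<longlonglongrightarrow> 0"
    using r_nonneg r_less_1 LIMSEQ_power_zero[of r]
    by (intro tendsto_mult_left_zero tendsto_divide_zero) auto
  then have "(\<lambda>k. cauchy_transform N r h z
      - (\<Sum>n<k. (\<integral>w. h w * cnj w ^ n \<partial>N) * of_real r ^ n * z ^ n)) \<longlonglongrightarrow> 0"
    by (rule Lim_null_comparison[OF always_eventually, rotated])
       (use cauchy_transform_partial_sum[OF h z] in auto)
  then show ?thesis
    using tendsto_diff[OF tendsto_const, of _ 0 _ "cauchy_transform N r h z"] by fastforce
qed

lemma cauchy_transform_bound:
  assumes "integrable N h" "cmod z = 1"
  shows "cmod (cauchy_transform N r h z) \<le> (\<integral>w. cmod (h w) \<partial>N) / (1 - r)"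
  using cauchy_transform_partial_sum[OF assms, of 0] by simp

lemma cauchy_transform_measurable:
  assumes h: "integrable N h"
  shows "cauchy_transform N r h \<in> borel_measurable circle_borel"
proof (rule borel_measurable_LIMSEQ_metric)
  have [measurable]: "(\<lambda>z. z) \<in> borel_measurable circle_borel"
    by (rule measurable_ident_circle_borel)
  show "(\<lambda>z. \<Sum>n<k. (\<integral>w. h w * cnj w ^ n \<partial>N) * of_real r ^ n * z ^ n)
      \<in> borel_measurable circle_borel" for k
    by measurable
  show "(\<lambda>k. \<Sum>n<k. (\<integral>w. h w * cnj w ^ n \<partial>N) * of_real r ^ n * z ^ n)
      \<longlonglongrightarrow> cauchy_transform N r h z" if "z \<in> space circle_borel" for z
    using that by (intro cauchy_transform_LIMSEQ h) simp
qed

lemma cauchy_transform_measurable_haar: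
  "integrable N h \<Longrightarrow> cauchy_transform N r h \<in> borel_measurable circle_haar"
  using cauchy_transform_measurable by (simp cong: measurable_cong_sets)

lemma cauchy_transform_H2:
  assumes h: "integrable N h"
  shows "cauchy_transform N r h \<in> H2"
proof (rule H2_closed)
  note measurable = cauchy_transform_measurable_haar[OF h]
  show "cauchy_transform N r h \<in> L2_circle"
    using cauchy_transform_bound[OF h] by (intro L2_circle_bounded(1)[OF measurable]) auto
  fix e :: real assume e: "0 < e"
  define I where "I = (\<integral>w. cmod (h w) \<partial>N)"
  have "(\<lambda>k. (r ^ k / (1 - r) * I)\<^sup>2) \<longlonglongrightarrow> (0 / (1 - r) * I)\<^sup>2"
    using r_nonneg r_less_1 by (intro tendsto_intros LIMSEQ_power_zero) auto
  from order_tendstoD(2)[OF this, of e] e obtain k where k: "(r ^ k / (1 - r) * I)\<^sup>2 < e"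
    by (auto simp: eventually_sequentially)
  let ?p = "\<lambda>z. \<Sum>n<k. ((\<integral>w. h w * cnj w ^ n \<partial>N) * of_real r ^ n) * z ^ n"
  have "L2_sq (\<lambda>z. cauchy_transform N r h z - ?p z) \<le> (r ^ k / (1 - r) * I)\<^sup>2"
    using cauchy_transform_partial_sum[OF h, of _ k] measurable
    by (intro L2_circle_bounded(2)) (auto simp: I_def)
  also note k
  finally show "\<exists>v\<in>H2. L2_sq (\<lambda>z. cauchy_transform N r h z - v z) < e"
    by (rule bexI[OF _ H2_poly])
qed

lemma one_minus_r_sq_pos: "0 < 1 - r\<^sup>2"
  using r_nonneg r_less_1 by (simp add: power_less_one_iff abs_square_less_1)

lemma poisson_kernel_eq:
  assumes z: "cmod z = 1" and w: "cmod w = 1"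
  shows "poisson_kernel r (z / w) = (1 - r\<^sup>2) / (2 * pi) * (cmod (1 / (1 - of_real r * z * cnj w)))\<^sup>2"
proof -
  have "z / w = z * cnj w"
    using w by (simp add: divide_conv_cnj)
  then show ?thesis by (simp add: poisson_kernel_def norm_divide power_divide mult.assoc)
qed

lemma poisson_kernel_commute:
  assumes z: "cmod z = 1" and w: "cmod w = 1"
  shows "poisson_kernel r (z / w) = poisson_kernel r (w / z)"
proof -
  have "cmod (1 - of_real r * z * cnj w) = cmod (cnj (1 - of_real r * z * cnj w))"
    by (simp only: complex_mod_cnj)
  also have "\<dots> = cmod (1 - of_real r * w * cnj z)"
    by (simp add: mult_ac)
  finally show ?thesis by (simp add: poisson_kernel_eq[OF z w] poisson_kernel_eq[OF w z] norm_divide)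
qed

text \<open>
  The closed form of the two-sided series of \<open>r ^ \<bar>n\<bar>\<close>: the geometric series, plus its conjugate,
  minus the constant term counted twice.
\<close>

lemma two_pi_poisson_kernel:
  assumes z: "cmod z = 1" and w: "cmod w = 1"
  shows "complex_of_real (2 * pi * poisson_kernel r (z / w))
      = 1 / (1 - of_real r * z * cnj w) + cnj (1 / (1 - of_real r * z * cnj w)) - 1"
proof -
  define x where "x = of_real r * z * cnj w"
  have nz: "1 - x \<noteq> 0"
    using cauchy_kernel_nonzero[OF assms] by (simp only: x_def not_False_eq_True)
  then have nz': "1 - cnj x \<noteq> 0"
    using complex_cnj_zero_iff[of "1 - x"] by (simp only: complex_cnj_diff complex_cnj_one not_False_eq_True)
  have "cmod x = r"
    using z w r_nonneg by (simp add: x_def norm_mult)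
  then have xx: "x * cnj x = of_real (r\<^sup>2)"
    by (simp flip: complex_norm_square)
  have "2 * pi * poisson_kernel r (z / w) = (1 - r\<^sup>2) / (cmod (1 - x))\<^sup>2"
    by (simp add: poisson_kernel_eq[OF assms] x_def norm_divide power_divide)
  then have "complex_of_real (2 * pi * poisson_kernel r (z / w)) = (1 - x * cnj x) / ((1 - x) * cnj (1 - x))"
    by (simp only: of_real_divide of_real_diff of_real_1 xx complex_norm_square)
  also have "\<dots> = 1 / (1 - x) + cnj (1 / (1 - x)) - 1"
  proof -
    have "(1 - (1 - p) * (1 - q)) / (p * q) = 1 / p + 1 / q - 1" if "p \<noteq> 0" "q \<noteq> 0" for p q :: complex
      using that by (simp add: field_simps)
    from this[OF nz nz'] show ?thesis by simp
  qed
  finally show ?thesis by (simp add: x_def)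
qed

lemma poisson_kernel_bounds:
  assumes z: "cmod z = 1" and w: "cmod w = 1"
  shows "0 < poisson_kernel r (z / w)" and "poisson_kernel r (z / w) \<le> 1 / (1 - r)\<^sup>2"
proof -
  have nz: "1 - of_real r * z * cnj w \<noteq> 0" by (rule cauchy_kernel_nonzero[OF assms])
  show "0 < poisson_kernel r (z / w)"
    unfolding poisson_kernel_eq[OF assms] using nz one_minus_r_sq_pos by simp
  have "(cmod (1 / (1 - of_real r * z * cnj w)))\<^sup>2 \<le> (1 / (1 - r))\<^sup>2"
    using cauchy_kernel_bound[OF assms] r_less_1
    by (intro power_mono) (auto simp: norm_divide frac_le)
  moreover have "(1 - r\<^sup>2) / (2 * pi) \<le> 1"
  proof -
    have "1 - r\<^sup>2 \<le> 2 * pi"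
      using pi_gt3 zero_le_power2[of r] by linarith
    then show ?thesis by simp
  qed
  ultimately have "poisson_kernel r (z / w) \<le> 1 * (1 / (1 - r))\<^sup>2"
    unfolding poisson_kernel_eq[OF assms] by (intro mult_mono) auto
  then show "poisson_kernel r (z / w) \<le> 1 / (1 - r)\<^sup>2"
    by (simp add: power_divide)
qed

lemma integrable_poisson_kernel:
  assumes z: "cmod z = 1"
  shows "integrable N (\<lambda>w. poisson_kernel r (z / w))"
proof (rule integrable_const_bound)
  show "AE w in N. norm (poisson_kernel r (z / w)) \<le> 1 / (1 - r)\<^sup>2"
    using poisson_kernel_bounds[OF z] by (auto intro!: AE_I2 simp: less_imp_le)
  show "(\<lambda>w. poisson_kernel r (z / w)) \<in> borel_measurable N"
    unfolding poisson_kernel_def by measurable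
qed

lemma poisson_conv_eq:
  assumes z: "cmod z = 1"
  shows "complex_of_real (2 * pi * poisson_conv r N z)
      = cauchy_transform N r (\<lambda>_. 1) z + cnj (cauchy_transform N r (\<lambda>_. 1) z) - of_real (measure N (sphere 0 1))"
proof -
  have int: "integrable N (\<lambda>w. 1 / (1 - of_real r * z * cnj w))"
    using z by (intro integrable_cauchy_kernel) auto
  have "complex_of_real (2 * pi * poisson_conv r N z)
      = (\<integral>w. complex_of_real (2 * pi * poisson_kernel r (z / w)) \<partial>N)"
    unfolding poisson_conv_def by simp
  also have "\<dots> = (\<integral>w. 1 / (1 - of_real r * z * cnj w) + cnj (1 / (1 - of_real r * z * cnj w)) - 1 \<partial>N)"
    using z by (intro Bochner_Integration.integral_cong) (auto simp only: two_pi_poisson_kernel space_N mem_sphere_0)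
  also have "\<dots> = (\<integral>w. 1 / (1 - of_real r * z * cnj w) \<partial>N)
      + (\<integral>w. cnj (1 / (1 - of_real r * z * cnj w)) \<partial>N) - (\<integral>w. 1 \<partial>N)"
    using int integrable_cnj[OF int] by simp
  also have "(\<integral>w. cnj (1 / (1 - of_real r * z * cnj w)) \<partial>N) = cnj (cauchy_transform N r (\<lambda>_. 1) z)"
    unfolding cauchy_transform_def by (rule Bochner_Integration.integral_cnj)
  finally show ?thesis by (simp add: cauchy_transform_def scaleR_conv_of_real)
qed

lemma poisson_conv_measurable [measurable]: "poisson_conv r N \<in> borel_measurable circle_haar"
proof -
  have [measurable]: "cauchy_transform N r (\<lambda>_. 1) \<in> borel_measurable circle_haar"
    by (rule cauchy_transform_measurable_haar) simp
  have "(\<lambda>z. Re ((cauchy_transform N r (\<lambda>_. 1) z + cnj (cauchy_transform N r (\<lambda>_. 1) z)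
      - of_real (measure N (sphere 0 1))) / of_real (2 * pi))) \<in> borel_measurable circle_haar"
    by measurable
  also have "?this \<longleftrightarrow> poisson_conv r N \<in> borel_measurable circle_haar"
  proof (rule measurable_cong)
    fix z assume "z \<in> space circle_haar"
    then show "Re ((cauchy_transform N r (\<lambda>_. 1) z + cnj (cauchy_transform N r (\<lambda>_. 1) z)
        - of_real (measure N (sphere 0 1))) / of_real (2 * pi)) = poisson_conv r N z"
      by (subst poisson_conv_eq[symmetric]) (auto simp flip: of_real_divide)
  qed
  finally show ?thesis .
qed

lemma poisson_conv_bound:
  assumes z: "cmod z = 1"
  shows "poisson_conv r N z \<le> measure N (sphere 0 1) / (1 - r)\<^sup>2"
proof -
  have "poisson_conv r N z \<le> (\<integral>w. 1 / (1 - r)\<^sup>2 \<partial>N)"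
    unfolding poisson_conv_def
    using poisson_kernel_bounds[OF z] integrable_poisson_kernel[OF z] by (intro integral_mono) auto
  then show ?thesis by simp
qed

lemma poisson_conv_nonneg: "cmod z = 1 \<Longrightarrow> 0 \<le> poisson_conv r N z"
  unfolding poisson_conv_def
  using poisson_kernel_bounds(1) by (intro integral_nonneg_AE AE_I2) (auto simp: less_imp_le)

lemma poisson_conv_pos:
  assumes nz: "emeasure N (sphere 0 1) \<noteq> 0" and z: "cmod z = 1"
  shows "0 < poisson_conv r N z"
proof -
  have "poisson_conv r N z \<noteq> 0"
  proof
    assume "poisson_conv r N z = 0"
    then have "AE w in N. poisson_kernel r (z / w) = 0"
      unfolding poisson_conv_def using poisson_kernel_bounds(1)[OF z]
      by (subst (asm) integral_nonneg_eq_0_iff_AE[OF integrable_poisson_kernel[OF z]])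
         (auto intro!: AE_I2 simp: less_imp_le)
    then have "AE w in N. False"
      using AE_space
      by eventually_elim (use poisson_kernel_bounds(1)[OF z] in \<open>force simp: space_N\<close>)
    then show False
      using nz ae_filter_eq_bot_iff[of N] by (simp add: trivial_limit_def)
  qed
  then show ?thesis using poisson_conv_nonneg[OF z] by simp
qed

text \<open>Cauchy--Schwarz, the square of the Cauchy kernel being a multiple of the Poisson kernel.\<close>

lemma cauchy_transform_sq_le:
  assumes [measurable]: "h \<in> borel_measurable N" and h2: "integrable N (\<lambda>w. (cmod (h w))\<^sup>2)"
    and z: "cmod z = 1"
  shows "(cmod (cauchy_transform N r h z))\<^sup>2
      \<le> (\<integral>w. (cmod (h w))\<^sup>2 \<partial>N) * (2 * pi / (1 - r\<^sup>2) * poisson_conv r N z)"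
proof -
  have k2: "(cmod (1 / (1 - of_real r * z * cnj w)))\<^sup>2 = 2 * pi / (1 - r\<^sup>2) * poisson_kernel r (z / w)"
    if "w \<in> space N" for w
    using that z one_minus_r_sq_pos by (subst poisson_kernel_eq) auto
  have "integrable N (\<lambda>w. 2 * pi / (1 - r\<^sup>2) * poisson_kernel r (z / w))"
    by (intro integrable_mult_right integrable_poisson_kernel z)
  then have int: "integrable N (\<lambda>w. (cmod (1 / (1 - of_real r * z * cnj w)))\<^sup>2)"
    using k2 by (subst Bochner_Integration.integrable_cong[OF refl k2])
  have "(cmod (\<integral>w. h w * (1 / (1 - of_real r * z * cnj w)) \<partial>N))\<^sup>2
      \<le> (\<integral>w. (cmod (h w))\<^sup>2 \<partial>N) * (\<integral>w. (cmod (1 / (1 - of_real r * z * cnj w)))\<^sup>2 \<partial>N)"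
    by (rule Cauchy_Schwarz_integral_norm[OF _ _ h2 int]) measurable
  also have "(\<integral>w. (cmod (1 / (1 - of_real r * z * cnj w)))\<^sup>2 \<partial>N)
      = (\<integral>w. 2 * pi / (1 - r\<^sup>2) * poisson_kernel r (z / w) \<partial>N)"
    by (intro Bochner_Integration.integral_cong refl k2)
  finally show ?thesis
    by (simp add: cauchy_transform_def poisson_conv_def)
qed

end

section \<open>The Hankel operator with a Poisson symbol\<close>

text \<open>
  The representative of a projection chosen in the definition is identified, up to a null set, with
  any function that satisfies the two defining conditions.
\<close>

lemma L2_proj_eq_AE:
  assumes V: "V \<subseteq> L2_circle" and V_diff: "\<And>u v. u \<in> V \<Longrightarrow> v \<in> V \<Longrightarrow> (\<lambda>z. u z - v z) \<in> V"
    and f: "f \<in> L2_circle" and g: "g \<in> V" and orth: "\<And>h. h \<in> V \<Longrightarrow> L2_inner (\<lambda>z. f z - g z) h = 0"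
  shows "L2_proj V f \<in> V" and "AE z in circle_haar. L2_proj V f z = g z"
proof -
  define p where "p = L2_proj V f"
  have "p \<in> V \<and> (\<forall>h\<in>V. L2_inner (\<lambda>z. f z - p z) h = 0)"
    unfolding p_def L2_proj_def by (rule someI[of _ g]) (use g orth in blast)
  then have p: "p \<in> V" and p_orth: "\<And>h. h \<in> V \<Longrightarrow> L2_inner (\<lambda>z. f z - p z) h = 0"
    by auto
  show "L2_proj V f \<in> V"
    using p by (simp add: p_def)
  define u where "u = (\<lambda>z. p z - g z)"
  have u: "u \<in> V"
    unfolding u_def by (rule V_diff[OF p g])
  have L2: "f \<in> L2_circle" "g \<in> L2_circle" "p \<in> L2_circle" "u \<in> L2_circle"
    using f g p u V by auto
  have int: "integrable circle_haar (\<lambda>z. (f z - g z) * cnj (u z))" "integrable circle_haar (\<lambda>z. (f z - p z) * cnj (u z))"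
    using L2 by (auto intro!: L2_circle_mult_integrable L2_circle_cnj L2_circle_diff)
  have "complex_of_real (L2_sq u) = (\<integral>z. u z * cnj (u z) \<partial>circle_haar)"
    unfolding L2_sq_def by (simp only: integral_complex_of_real[symmetric] complex_norm_square)
  also have "\<dots> = (\<integral>z. (f z - g z) * cnj (u z) - (f z - p z) * cnj (u z) \<partial>circle_haar)"
    by (simp add: u_def algebra_simps)
  also have "\<dots> = 0"
    using orth[OF u] p_orth[OF u] by (simp add: Bochner_Integration.integral_diff[OF int] L2_inner_def)
  finally have "L2_sq u = 0" by simp
  then have "AE z in circle_haar. (cmod (u z))\<^sup>2 = 0"
    unfolding L2_sq_def
    by (subst (asm) integral_nonneg_eq_0_iff_AE[OF L2_circle_integrable_sq[OF L2(4)]]) auto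
  then show "AE z in circle_haar. L2_proj V f z = g z"
    by eventually_elim (simp add: u_def p_def)
qed

lemma L2_inner_cnj_commute: "L2_inner f g = cnj (L2_inner g f)"
  by (simp add: L2_inner_def mult.commute flip: Bochner_Integration.integral_cnj)

lemma H2_minus_diff:
  assumes "u \<in> H2_minus" "v \<in> H2_minus"
  shows "(\<lambda>z. u z - v z) \<in> H2_minus"
proof -
  have L2: "u \<in> L2_circle" "v \<in> L2_circle"
    using assms by (auto simp: H2_minus_def)
  have "L2_inner (\<lambda>z. u z - v z) h = L2_inner u h - L2_inner v h" if "h \<in> H2_0" for h
  proof -
    have "h \<in> L2_circle" using that by (intro H2_L2_circle H2_0_H2)
    then show ?thesis
      using L2 by (simp add: L2_inner_def left_diff_distrib L2_circle_mult_integrable L2_circle_cnj)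
  qed
  then show ?thesis
    using assms L2 by (simp add: H2_minus_def L2_circle_diff(1))
qed

lemma cnj_H2_in_H2_minus:
  assumes "g \<in> H2"
  shows "(\<lambda>z. cnj (g z)) \<in> H2_minus"
proof -
  have "L2_inner (\<lambda>z. cnj (g z)) h = 0" if "h \<in> H2_0" for h
  proof -
    have "L2_inner (\<lambda>z. cnj (g z)) h = cnj (\<integral>z. h z * g z \<partial>circle_haar)"
      by (simp add: L2_inner_def mult.commute flip: Bochner_Integration.integral_cnj)
    then show ?thesis
      using integral_H2_0_mult_H2[OF that assms] by simp
  qed
  then show ?thesis
    using assms by (simp add: H2_minus_def L2_circle_cnj H2_L2_circle)
qed

lemma L2_circle_integrable:
  assumes "f \<in> L2_circle"
  shows "integrable circle_haar f"
  using L2_circle_mult_integrable[OF assms power_L2_circle[of 0]] by simp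

lemma integral_cmod_sq_le:
  assumes "f \<in> L2_circle"
  shows "(\<integral>z. cmod (f z) \<partial>circle_haar)\<^sup>2 \<le> L2_sq f"
proof -
  have "(\<lambda>z. complex_of_real (cmod (f z))) \<in> L2_circle"
    using assms by (auto simp: L2_circle_def)
  from L2_circle_mult_bound[OF this power_L2_circle[of 0]] show ?thesis
    using L2_sq_powi[of 0] by (simp add: L2_sq_def)
qed

context circle_measure
begin

interpretation haar: circle_measure circle_haar r
  by unfold_locales (auto simp: r_nonneg r_less_1)

text \<open>
  For \<open>f\<close> in \<open>H2\<close> with Fourier series \<open>\<Sum>n. a n * z ^ n\<close> this is \<open>\<Sum>n. a n * (r * w) ^ n\<close>,
  the value at \<open>r * w\<close> of the holomorphic extension of \<open>f\<close> to the disc.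
\<close>

definition dilate :: "(complex \<Rightarrow> complex) \<Rightarrow> complex \<Rightarrow> complex" where
  "dilate f = cauchy_transform circle_haar r f"

lemma dilate_measurable [measurable]: "f \<in> L2_circle \<Longrightarrow> dilate f \<in> borel_measurable N"
  unfolding dilate_def using haar.cauchy_transform_measurable[OF L2_circle_integrable, of f] sets_N
  by (simp cong: measurable_cong_sets)

lemma dilate_bound:
  assumes f: "f \<in> L2_circle" and w: "cmod w = 1"
  shows "cmod (dilate f w) \<le> sqrt (L2_sq f) / (1 - r)"
proof -
  have "cmod (dilate f w) \<le> (\<integral>z. cmod (f z) \<partial>circle_haar) / (1 - r)"
    unfolding dilate_def by (rule haar.cauchy_transform_bound[OF L2_circle_integrable[OF f] w])
  also have "\<dots> \<le> sqrt (L2_sq f) / (1 - r)"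
    using integral_cmod_sq_le[OF f] r_less_1 by (intro divide_right_mono real_le_rsqrt) auto
  finally show ?thesis .
qed

lemma dilate_add:
  "f \<in> L2_circle \<Longrightarrow> g \<in> L2_circle \<Longrightarrow> cmod w = 1 \<Longrightarrow> dilate (\<lambda>z. f z + g z) w = dilate f w + dilate g w"
  by (simp add: dilate_def cauchy_transform_def add_divide_distrib haar.integrable_cauchy_kernel L2_circle_integrable)

lemma dilate_cmult: "dilate (\<lambda>z. c * f z) w = c * dilate f w"
  by (simp add: dilate_def cauchy_transform_def flip: times_divide_eq_right)

lemma dilate_power:
  assumes w: "cmod w = 1"
  shows "dilate (\<lambda>z. z ^ k) w = (of_real r * w) ^ k"
proof -
  have coeff: "(\<integral>z. z ^ k * cnj z ^ n \<partial>circle_haar) = (if n = k then 1 else 0)" for n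
  proof -
    have "(\<integral>z. z ^ k * cnj z ^ n \<partial>circle_haar) = fourier_coeff (\<lambda>z. z powi int k) (int n)"
      unfolding fourier_coeff_def
      by (intro Bochner_Integration.integral_cong) (auto simp: power_int_minus_circle)
    then show ?thesis unfolding fourier_coeff_powi by auto
  qed
  have "(\<lambda>N. \<Sum>n<N. (if n = k then 1 else 0) * of_real r ^ n * w ^ n) \<longlonglongrightarrow> dilate (\<lambda>z. z ^ k) w"
    using haar.cauchy_transform_LIMSEQ[OF L2_circle_integrable[OF power_L2_circle[of k]] w]
    by (simp only: coeff dilate_def)
  moreover have "(\<lambda>N. \<Sum>n<N. (if n = k then 1 else 0) * of_real r ^ n * w ^ n) \<longlonglongrightarrow> (of_real r * w) ^ k"
  proof (rule tendsto_eventually)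
    have "(\<Sum>n<N. (if n = k then 1 else 0) * of_real r ^ n * w ^ n) = (of_real r * w) ^ k" if "k < N" for N
      using that by (simp add: if_distrib[of "\<lambda>c. c * _"] power_mult_distrib cong: if_cong)
    then show "\<forall>\<^sub>F N in sequentially. (\<Sum>n<N. (if n = k then 1 else 0) * of_real r ^ n * w ^ n) = (of_real r * w) ^ k"
      using eventually_gt_at_top[of k] by (rule eventually_mono[rotated]) auto
  qed
  ultimately show ?thesis by (rule LIMSEQ_unique)
qed

text \<open>
  The explicit candidate for the projection of \<open>cnj f * \<phi>\<close> to \<open>H2\<close>, where \<open>\<phi>\<close> is the
  Poisson integral of \<open>N\<close>; its conjugate is the candidate for \<open>hankel \<phi> f\<close>.
\<close>

definition hardy_part :: "(complex \<Rightarrow> complex) \<Rightarrow> complex \<Rightarrow> complex" where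
  "hardy_part f z = cauchy_transform N r (\<lambda>w. cnj (dilate f w)) z / (2 * pi)"

text \<open>
  What is left of \<open>\<phi> * f\<close> after subtracting the candidate for its coanalytic part. The candidate
  is correct exactly because this remainder lies in \<open>H2_0\<close> whenever \<open>f\<close> does.
\<close>

definition analytic_remainder :: "(complex \<Rightarrow> complex) \<Rightarrow> complex \<Rightarrow> complex" where
  "analytic_remainder f z = of_real (poisson_conv r N z) * f z - cnj (hardy_part f z)"

lemma integrable_cnj_dilate:
  assumes f: "f \<in> L2_circle"
  shows "integrable N (\<lambda>w. cnj (dilate f w))"
  using dilate_bound[OF f] dilate_measurable[OF f]
  by (intro integrable_bounded[where B = "sqrt (L2_sq f) / (1 - r)"]) auto

lemma hardy_part_H2: "f \<in> L2_circle \<Longrightarrow> hardy_part f \<in> H2"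
  using H2_cmult[OF cauchy_transform_H2[OF integrable_cnj_dilate], of f "1 / (2 * pi)"]
  by (simp add: hardy_part_def[abs_def])

lemma hardy_part_bound:
  assumes f: "f \<in> L2_circle" and z: "cmod z = 1"
  shows "cmod (hardy_part f z) \<le> measure N (sphere 0 1) / (1 - r)\<^sup>2 * sqrt (L2_sq f)"
proof -
  have "cmod (cauchy_transform N r (\<lambda>w. cnj (dilate f w)) z) \<le> (\<integral>w. cmod (dilate f w) \<partial>N) / (1 - r)"
    using cauchy_transform_bound[OF integrable_cnj_dilate[OF f] z] by simp
  also have "(\<integral>w. cmod (dilate f w) \<partial>N) \<le> (\<integral>w. sqrt (L2_sq f) / (1 - r) \<partial>N)"
    using dilate_bound[OF f] integrable_norm[OF integrable_cnj_dilate[OF f]]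
    by (intro integral_mono) auto
  finally have "cmod (cauchy_transform N r (\<lambda>w. cnj (dilate f w)) z)
      \<le> measure N (sphere 0 1) / (1 - r)\<^sup>2 * sqrt (L2_sq f)"
    using r_less_1 by (simp add: divide_right_mono power2_eq_square)
  moreover have "cmod (hardy_part f z) \<le> cmod (cauchy_transform N r (\<lambda>w. cnj (dilate f w)) z)"
  proof -
    have "1 \<le> 2 * pi" using pi_gt3 by linarith
    then show ?thesis
      by (simp add: hardy_part_def norm_divide divide_le_eq) 
         (metis mult.commute mult_left_mono mult.right_neutral norm_ge_zero)
  qed
  ultimately show ?thesis by (rule order_trans[rotated])
qed

lemma poisson_mult_L2_circle:
  assumes "f \<in> L2_circle"
  shows "(\<lambda>z. of_real (poisson_conv r N z) * f z) \<in> L2_circle"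
    and "L2_sq (\<lambda>z. of_real (poisson_conv r N z) * f z) \<le> (measure N (sphere 0 1) / (1 - r)\<^sup>2)\<^sup>2 * L2_sq f"
  using poisson_conv_bound poisson_conv_nonneg
  by (auto intro!: L2_circle_mult_bounded[OF assms])

lemma analytic_remainder_L2_circle:
  assumes f: "f \<in> L2_circle"
  shows "analytic_remainder f \<in> L2_circle"
    and "L2_sq (analytic_remainder f) \<le> 4 * (measure N (sphere 0 1) / (1 - r)\<^sup>2)\<^sup>2 * L2_sq f"
proof -
  let ?B = "measure N (sphere 0 1) / (1 - r)\<^sup>2"
  have hp: "(\<lambda>z. cnj (hardy_part f z)) \<in> L2_circle"
    by (intro L2_circle_cnj H2_L2_circle hardy_part_H2 f)
  show "analytic_remainder f \<in> L2_circle"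
    unfolding analytic_remainder_def[abs_def] by (intro L2_circle_diff poisson_mult_L2_circle f hp)
  have "L2_sq (\<lambda>z. cnj (hardy_part f z)) \<le> (?B * sqrt (L2_sq f))\<^sup>2"
    using hp hardy_part_bound[OF f] by (intro L2_circle_bounded) (auto dest: L2_circle_measurable)
  also have "\<dots> = ?B\<^sup>2 * L2_sq f"
    by (simp only: power_mult_distrib real_sqrt_pow2[OF L2_sq_nonneg])
  finally show "L2_sq (analytic_remainder f) \<le> 4 * ?B\<^sup>2 * L2_sq f"
    unfolding analytic_remainder_def[abs_def]
    using L2_circle_diff(2)[OF poisson_mult_L2_circle(1)[OF f] hp] poisson_mult_L2_circle(2)[OF f]
    by linarith
qed

lemma hardy_part_add:
  assumes "f \<in> L2_circle" "g \<in> L2_circle" "cmod z = 1"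
  shows "hardy_part (\<lambda>z. f z + g z) z = hardy_part f z + hardy_part g z"
proof -
  have "cauchy_transform N r (\<lambda>w. cnj (dilate (\<lambda>z. f z + g z) w)) z
      = (\<integral>w. cnj (dilate f w) / (1 - of_real r * z * cnj w) + cnj (dilate g w) / (1 - of_real r * z * cnj w) \<partial>N)"
    unfolding cauchy_transform_def using assms
    by (intro Bochner_Integration.integral_cong) (auto simp: dilate_add add_divide_distrib)
  then show ?thesis
    using assms integrable_cauchy_kernel[OF integrable_cnj_dilate]
    by (simp add: hardy_part_def cauchy_transform_def add_divide_distrib)
qed

lemma hardy_part_cmult: "hardy_part (\<lambda>z. c * f z) z = cnj c * hardy_part f z"
  by (simp add: hardy_part_def dilate_cmult cauchy_transform_def flip: times_divide_eq_right)

lemma analytic_remainder_add: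
  "f \<in> L2_circle \<Longrightarrow> g \<in> L2_circle \<Longrightarrow> cmod z = 1 \<Longrightarrow>
    analytic_remainder (\<lambda>z. f z + g z) z = analytic_remainder f z + analytic_remainder g z"
  by (simp add: analytic_remainder_def hardy_part_add algebra_simps)

lemma analytic_remainder_cmult: "analytic_remainder (\<lambda>z. c * f z) z = c * analytic_remainder f z"
  by (simp add: analytic_remainder_def hardy_part_cmult algebra_simps)

text \<open>
  With \<open>q = r * w * cnj z\<close> the coanalytic half of the kernel contributes
  \<open>(z ^ k - (r * w) ^ k) / (1 - q) = z ^ k * (1 - q ^ k) / (1 - q)\<close>, a finite geometric sum in which
  only positive powers of \<open>z\<close> survive; the analytic half gives \<open>z ^ k\<close> times a Cauchy transform
  without constant term.
\<close>

lemma analytic_remainder_power: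
  assumes z: "cmod z = 1"
  shows "analytic_remainder (\<lambda>z. z ^ k) z
    = (1 / (2 * pi)) * ((\<Sum>j<k. (of_real r ^ j * (\<integral>w. w ^ j \<partial>N)) * z ^ (k - j))
        + of_real r * (z ^ Suc k * cauchy_transform N r cnj z))"
proof -
  define K where "K = (\<lambda>w. 1 / (1 - of_real r * z * cnj w))"
  have zz: "z * cnj z = 1"
    using z by (simp flip: complex_norm_square)
  have int_K: "integrable N K"
    unfolding K_def using z by (intro integrable_cauchy_kernel) auto
  have K_meas [measurable]: "K \<in> borel_measurable N" using int_K by simp
  have B: "cmod (K w) \<le> 1 / (1 - r)" if "cmod w = 1" for w
    using cauchy_kernel_bound[OF z that] r_less_1 by (simp add: K_def norm_divide frac_le)
  have int_power: "integrable N (\<lambda>w. w ^ j)" for j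
    by (rule integrable_bounded[where B = 1]) (auto simp: norm_power)
  have int_wK: "integrable N (\<lambda>w. (of_real r * w) ^ k * cnj (K w))"
    unfolding power_mult_distrib mult.assoc
    using B by (intro integrable_mult_right integrable_mult_bounded[OF int_power]) auto
  have int_cK: "integrable N (\<lambda>w. cnj w * K w)"
    using integrable_cauchy_kernel[OF integrable_cnj[OF int_power[of 1]] z] by (simp add: K_def)
  have phi: "complex_of_real (2 * pi * poisson_conv r N z) = (\<integral>w. K w + cnj (K w) - 1 \<partial>N)"
    using int_K integrable_cnj[OF int_K] unfolding poisson_conv_eq[OF z] cauchy_transform_def
    by (simp add: scaleR_conv_of_real flip: K_def)
  have dilate: "cnj (cauchy_transform N r (\<lambda>w. cnj (dilate (\<lambda>z. z ^ k) w)) z)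
      = (\<integral>w. (of_real r * w) ^ k * cnj (K w) \<partial>N)"
    unfolding cauchy_transform_def Bochner_Integration.integral_cnj[symmetric]
    by (intro Bochner_Integration.integral_cong) (auto simp: dilate_power K_def)
  have pointwise: "z ^ k * (K w + cnj (K w) - 1) - (of_real r * w) ^ k * cnj (K w)
      = (\<Sum>j<k. (of_real r ^ j * z ^ (k - j)) * w ^ j) + (of_real r * z ^ Suc k) * (cnj w * K w)"
    if w: "cmod w = 1" for w
  proof -
    define x where "x = of_real r * z * cnj w"
    define q where "q = cnj x"
    have nz: "1 - x \<noteq> 0"
      using cauchy_kernel_nonzero[OF z w] by (simp only: x_def not_False_eq_True)
    then have nz': "1 - q \<noteq> 0"
      using complex_cnj_zero_iff[of "1 - x"] by (simp only: q_def complex_cnj_diff complex_cnj_one not_False_eq_True)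
    have K: "K w = 1 / (1 - x)" "cnj (K w) = 1 / (1 - q)"
      by (simp_all add: K_def x_def q_def)
    have qz: "q * z = of_real r * w"
      using zz by (simp add: q_def x_def mult_ac)
    have "z ^ k * (K w - 1) = z ^ k * x * K w"
      using nz by (simp add: K field_simps)
    also have "\<dots> = (of_real r * z ^ Suc k) * (cnj w * K w)"
      by (simp add: x_def mult_ac)
    finally have analytic: "z ^ k * (K w - 1) = (of_real r * z ^ Suc k) * (cnj w * K w)" .
    have "z ^ k * cnj (K w) - (of_real r * w) ^ k * cnj (K w) = z ^ k * ((1 - q ^ k) / (1 - q))"
      unfolding K(2) qz[symmetric] by (simp add: power_mult_distrib diff_divide_distrib algebra_simps)
    also have "\<dots> = (\<Sum>j<k. z ^ k * q ^ j)"
      using nz' by (subst sum_distrib_left[symmetric], subst sum_gp_strict) auto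
    also have "\<dots> = (\<Sum>j<k. (of_real r ^ j * z ^ (k - j)) * w ^ j)"
    proof (rule sum.cong[OF refl])
      fix j assume "j \<in> {..<k}"
      then have "z ^ k = z ^ (k - j) * z ^ j" by (simp flip: power_add)
      then have "z ^ k * q ^ j = z ^ (k - j) * (q * z) ^ j"
        by (simp add: power_mult_distrib)
      then show "z ^ k * q ^ j = (of_real r ^ j * z ^ (k - j)) * w ^ j"
        by (simp add: qz power_mult_distrib)
    qed
    finally have coanalytic: "z ^ k * cnj (K w) - (of_real r * w) ^ k * cnj (K w)
        = (\<Sum>j<k. (of_real r ^ j * z ^ (k - j)) * w ^ j)" .
    have "z ^ k * (K w + cnj (K w) - 1) - (of_real r * w) ^ k * cnj (K w)
        = (z ^ k * cnj (K w) - (of_real r * w) ^ k * cnj (K w)) + z ^ k * (K w - 1)"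
      by (simp add: algebra_simps)
    then show ?thesis unfolding coanalytic analytic .
  qed
  have "2 * pi * analytic_remainder (\<lambda>z. z ^ k) z
      = z ^ k * complex_of_real (2 * pi * poisson_conv r N z)
        - cnj (cauchy_transform N r (\<lambda>w. cnj (dilate (\<lambda>z. z ^ k) w)) z)"
    by (simp add: analytic_remainder_def hardy_part_def algebra_simps)
  also have "\<dots> = (\<integral>w. z ^ k * (K w + cnj (K w) - 1) - (of_real r * w) ^ k * cnj (K w) \<partial>N)"
    unfolding phi dilate using int_K integrable_cnj[OF int_K] int_wK by simp
  also have "\<dots> = (\<integral>w. (\<Sum>j<k. (of_real r ^ j * z ^ (k - j)) * w ^ j)
      + (of_real r * z ^ Suc k) * (cnj w * K w) \<partial>N)"
    by (intro Bochner_Integration.integral_cong refl pointwise) simp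
  also have "\<dots> = (\<integral>w. (\<Sum>j<k. (of_real r ^ j * z ^ (k - j)) * w ^ j) \<partial>N)
      + (\<integral>w. (of_real r * z ^ Suc k) * (cnj w * K w) \<partial>N)"
    by (intro Bochner_Integration.integral_add Bochner_Integration.integrable_sum
        integrable_mult_right int_power int_cK)
  also have "(\<integral>w. (\<Sum>j<k. (of_real r ^ j * z ^ (k - j)) * w ^ j) \<partial>N)
      = (\<Sum>j<k. (of_real r ^ j * (\<integral>w. w ^ j \<partial>N)) * z ^ (k - j))"
    using int_power by (subst Bochner_Integration.integral_sum) (auto simp: mult_ac)
  also have "(\<integral>w. (of_real r * z ^ Suc k) * (cnj w * K w) \<partial>N)
      = of_real r * (z ^ Suc k * cauchy_transform N r cnj z)"
    unfolding Bochner_Integration.integral_mult_right_zero by (simp add: K_def cauchy_transform_def)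
  finally show ?thesis by (simp add: field_simps)
qed

lemma analytic_remainder_power_H2_0:
  assumes "0 < k"
  shows "analytic_remainder (\<lambda>z. z ^ k) \<in> H2_0"
proof (rule H2_0_cong)
  have "integrable N cnj"
    by (rule integrable_bounded[where B = 1]) auto
  then have "cauchy_transform N r cnj \<in> H2" by (rule cauchy_transform_H2)
  then show "(\<lambda>z. (1 / (2 * pi)) * ((\<Sum>j<k. (of_real r ^ j * (\<integral>w. w ^ j \<partial>N)) * z ^ (k - j))
      + of_real r * (z ^ Suc k * cauchy_transform N r cnj z))) \<in> H2_0"
    by (intro H2_0_cmult H2_0_add H2_0_sum H2_0_monomial H2_0_shift) auto
qed (simp add: analytic_remainder_power)

lemma analytic_remainder_poly_H2_0:
  assumes "a 0 = 0"
  shows "analytic_remainder (\<lambda>z. \<Sum>n<M. a n * z ^ n) \<in> H2_0"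
proof (induction M)
  case 0
  have "analytic_remainder (\<lambda>z. 0) z = 0" for z
    using analytic_remainder_cmult[of 0 "\<lambda>_. 0" z] by simp
  then show ?case using H2_0_cong[OF zero_H2_0] by simp
next
  case (Suc M)
  have "(\<lambda>z. a M * analytic_remainder (\<lambda>z. z ^ M) z) \<in> H2_0"
  proof (cases "M = 0")
    case True
    then show ?thesis using assms zero_H2_0 by simp
  qed (intro H2_0_cmult analytic_remainder_power_H2_0, simp)
  from H2_0_add[OF Suc this] show ?case
  proof (rule H2_0_cong)
    show "analytic_remainder (\<lambda>z. \<Sum>n<M. a n * z ^ n) z + a M * analytic_remainder (\<lambda>z. z ^ M) z
        = analytic_remainder (\<lambda>z. \<Sum>n<Suc M. a n * z ^ n) z" if "z \<in> sphere 0 1" for z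
      using that by (simp add: analytic_remainder_add analytic_remainder_cmult poly_L2_circle L2_circle_cmult power_L2_circle)
  qed
qed

text \<open>
  Approximation by the Fourier partial sums of \<open>f\<close>, whose constant terms vanish.
\<close>

lemma analytic_remainder_H2_0:
  assumes f: "f \<in> H2_0"
  shows "analytic_remainder f \<in> H2_0"
proof (rule H2_0_closed)
  have fL: "f \<in> L2_circle" using f by (intro H2_L2_circle H2_0_H2)
  show "analytic_remainder f \<in> L2_circle" by (rule analytic_remainder_L2_circle(1)[OF fL])
  fix e :: real assume e: "0 < e"
  define K where "K = 4 * (measure N (sphere 0 1) / (1 - r)\<^sup>2)\<^sup>2 + 1"
  have K: "0 < K" by (simp add: K_def add_nonneg_pos)
  obtain M where M: "L2_sq (\<lambda>z. f z - (\<Sum>n<M. fourier_coeff f (int n) * z ^ n)) < e / K"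
    using H2_fourier_approx[OF H2_0_H2[OF f], of "e / K"] e K by auto
  define p where "p = (\<lambda>z. \<Sum>n<M. fourier_coeff f (int n) * z ^ n)"
  have pL: "p \<in> L2_circle" unfolding p_def by (rule poly_L2_circle)
  have d: "(\<lambda>z. f z - p z) \<in> L2_circle" using fL pL by (rule L2_circle_diff)
  have "L2_sq (\<lambda>z. analytic_remainder f z - analytic_remainder p z) = L2_sq (analytic_remainder (\<lambda>z. f z - p z))"
    unfolding L2_sq_def
  proof (intro Bochner_Integration.integral_cong refl)
    fix z assume "z \<in> space circle_haar"
    then have "analytic_remainder (\<lambda>z. (f z - p z) + p z) z = analytic_remainder (\<lambda>z. f z - p z) z + analytic_remainder p z"
      by (intro analytic_remainder_add d pL) simp
    then show "(cmod (analytic_remainder f z - analytic_remainder p z))\<^sup>2 = (cmod (analytic_remainder (\<lambda>z. f z - p z) z))\<^sup>2"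
      by simp
  qed
  also have "\<dots> \<le> K * L2_sq (\<lambda>z. f z - p z)"
    using analytic_remainder_L2_circle(2)[OF d] unfolding K_def
    by (rule order_trans) (intro mult_right_mono, auto)
  also have "\<dots> < e"
    using M K by (simp add: p_def field_simps)
  finally have "L2_sq (\<lambda>z. analytic_remainder f z - analytic_remainder p z) < e" .
  moreover have "analytic_remainder p \<in> H2_0"
    using f unfolding p_def by (intro analytic_remainder_poly_H2_0) (simp add: H2_0_def)
  ultimately show "\<exists>v\<in>H2_0. L2_sq (\<lambda>z. analytic_remainder f z - v z) < e" by (rule bexI)
qed

lemma R_plus_eq_hardy_part:
  assumes f: "f \<in> H2_0"
  shows "R_plus (\<lambda>w. cnj (f w) * of_real (poisson_conv r N w)) \<in> H2"
    and "AE z in circle_haar. R_plus (\<lambda>w. cnj (f w) * of_real (poisson_conv r N w)) z = hardy_part f z"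
proof -
  have fL: "f \<in> L2_circle" using f by (intro H2_L2_circle H2_0_H2)
  have g: "hardy_part f \<in> H2" by (rule hardy_part_H2[OF fL])
  have phi_f: "(\<lambda>w. cnj (f w) * of_real (poisson_conv r N w)) \<in> L2_circle"
    using L2_circle_cnj[OF poisson_mult_L2_circle(1)[OF fL]] by (simp add: mult.commute)
  have orth: "L2_inner (\<lambda>z. cnj (f z) * of_real (poisson_conv r N z) - hardy_part f z) h = 0" if "h \<in> H2" for h
  proof -
    have "L2_inner (\<lambda>z. cnj (f z) * of_real (poisson_conv r N z) - hardy_part f z) h
        = cnj (\<integral>z. analytic_remainder f z * h z \<partial>circle_haar)"
      unfolding L2_inner_def Bochner_Integration.integral_cnj[symmetric]
      by (simp add: analytic_remainder_def mult.commute[of "cnj (f _)"])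
    then show ?thesis
      using integral_H2_0_mult_H2[OF analytic_remainder_H2_0[OF f] that] by simp
  qed
  have V: "H2 \<subseteq> L2_circle" by (auto dest: H2_L2_circle)
  show "R_plus (\<lambda>w. cnj (f w) * of_real (poisson_conv r N w)) \<in> H2"
    "AE z in circle_haar. R_plus (\<lambda>w. cnj (f w) * of_real (poisson_conv r N w)) z = hardy_part f z"
    unfolding R_plus_def
    by (rule L2_proj_eq_AE[OF V _ phi_f g]; fact H2_diff orth)+
qed

lemma hankel_eq_cnj_hardy_part:
  assumes f: "f \<in> H2_0"
  shows "hankel (\<lambda>w. of_real (poisson_conv r N w)) f \<in> L2_circle"
    and "AE z in circle_haar. hankel (\<lambda>w. of_real (poisson_conv r N w)) f z = cnj (hardy_part f z)"
proof -
  have fL: "f \<in> L2_circle" using f by (intro H2_L2_circle H2_0_H2)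
  have g: "(\<lambda>z. cnj (hardy_part f z)) \<in> H2_minus"
    by (intro cnj_H2_in_H2_minus hardy_part_H2 fL)
  have orth: "L2_inner (\<lambda>z. of_real (poisson_conv r N z) * f z - cnj (hardy_part f z)) h = 0"
    if "h \<in> H2_minus" for h
    using that analytic_remainder_H2_0[OF f]
    by (subst L2_inner_cnj_commute) (simp add: H2_minus_def analytic_remainder_def[abs_def])
  have V: "H2_minus \<subseteq> L2_circle" by (auto simp: H2_minus_def)
  have "L2_proj H2_minus (\<lambda>z. of_real (poisson_conv r N z) * f z) \<in> H2_minus"
    by (rule L2_proj_eq_AE[OF V _ poisson_mult_L2_circle(1)[OF fL] g]; fact H2_minus_diff orth)
  then show "hankel (\<lambda>w. of_real (poisson_conv r N w)) f \<in> L2_circle"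
    unfolding hankel_def R_minus_def using V by blast
  show "AE z in circle_haar. hankel (\<lambda>w. of_real (poisson_conv r N w)) f z = cnj (hardy_part f z)"
    unfolding hankel_def R_minus_def
    by (rule L2_proj_eq_AE[OF V _ poisson_mult_L2_circle(1)[OF fL] g]; fact H2_minus_diff orth)
qed

section \<open>The weighted estimate\<close>

lemma poisson_conv_haar:
  assumes w: "cmod w = 1"
  shows "2 * pi * poisson_conv r circle_haar w = 1"
proof -
  have "cauchy_transform circle_haar r (\<lambda>_. 1) w = 1"
    using dilate_power[OF w, of 0] by (simp add: dilate_def)
  then have "complex_of_real (2 * pi * poisson_conv r circle_haar w) = complex_of_real 1"
    unfolding haar.poisson_conv_eq[OF w] by simp
  then show ?thesis unfolding of_real_eq_iff .
qed

text \<open>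
  The factor \<open>r\<close> of the final constant comes from here. On the circle \<open>f z * cnj z = g z\<close> with
  \<open>g\<close> in \<open>H2\<close>, and the formula is \<open>f (r * w) = r * w * g (r * w)\<close> with \<open>g\<close> recovered by its
  Poisson integral. Instead of introducing \<open>g\<close>, the proof expands
  \<open>x * (1 / (1 - x) + cnj (1 / (1 - x)) - 1) = 1 / (1 - x) - 1 + r\<^sup>2 * cnj (1 / (1 - x))\<close> for
  \<open>x = r * w * cnj z\<close>: the last two terms integrate to \<open>0\<close> against a function in \<open>H2_0\<close>.
\<close>

lemma dilate_eq_integral_poisson:
  assumes f: "f \<in> H2_0" and w: "cmod w = 1"
  shows "dilate f w
    = (\<integral>z. f z * (of_real r * w * cnj z * of_real (2 * pi * poisson_kernel r (w / z))) \<partial>circle_haar)"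
proof -
  define K where "K = (\<lambda>z. 1 / (1 - of_real r * w * cnj z))"
  have fL: "f \<in> L2_circle" using f by (intro H2_L2_circle H2_0_H2)
  have int_f: "integrable circle_haar f" by (rule L2_circle_integrable[OF fL])
  have int_K: "integrable circle_haar (\<lambda>z. f z * K z)"
    using haar.integrable_cauchy_kernel[OF int_f w] by (simp add: K_def)
  have int_cK: "integrable circle_haar (\<lambda>z. f z * cnj (K z))"
    using integrable_cnj[OF haar.integrable_cauchy_kernel[OF integrable_cnj[OF int_f] w]]
    by (simp add: K_def)
  have mean: "(\<integral>z. f z \<partial>circle_haar) = 0"
    using f by (simp add: H2_0_def fourier_coeff_def)
  \<comment> \<open>These are the conjugates of the nonpositive Fourier coefficients of \<open>f\<close>.\<close>
  have coeff: "(\<integral>z. cnj (f z) * cnj z ^ n \<partial>circle_haar) = 0" for n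
  proof -
    have "(\<integral>z. cnj (f z) * cnj z ^ n \<partial>circle_haar) = cnj (\<integral>z. f z * z ^ n \<partial>circle_haar)"
      unfolding Bochner_Integration.integral_cnj[symmetric] by simp
    also have "\<dots> = 0"
      using integral_H2_0_mult_H2[OF f H2_poly[where N = "Suc n" and a = "\<lambda>k. if k = n then 1 else 0"]]
      by (simp add: if_distrib[of "\<lambda>c. c * _"] cong: if_cong)
    finally show ?thesis .
  qed
  have "cauchy_transform circle_haar r (\<lambda>z. cnj (f z)) w = 0"
    using haar.cauchy_transform_LIMSEQ[OF integrable_cnj[OF int_f] w]
    by (simp add: coeff LIMSEQ_const_iff)
  then have "cnj (\<integral>z. cnj (f z) / (1 - of_real r * w * cnj z) \<partial>circle_haar) = 0"
    by (simp add: cauchy_transform_def)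
  then have coanalytic: "(\<integral>z. f z * cnj (K z) \<partial>circle_haar) = 0"
    unfolding Bochner_Integration.integral_cnj[symmetric] by (simp add: K_def)
  have "(\<integral>z. f z * (of_real r * w * cnj z * of_real (2 * pi * poisson_kernel r (w / z))) \<partial>circle_haar)
      = (\<integral>z. f z * K z - f z + of_real (r\<^sup>2) * (f z * cnj (K z)) \<partial>circle_haar)"
  proof (intro Bochner_Integration.integral_cong refl)
    fix z assume "z \<in> space circle_haar"
    then have z: "cmod z = 1" by simp
    define x where "x = of_real r * w * cnj z"
    have nz: "1 - x \<noteq> 0"
      using cauchy_kernel_nonzero[OF w z] by (simp only: x_def not_False_eq_True)
    then have nz': "1 - cnj x \<noteq> 0"
      using complex_cnj_zero_iff[of "1 - x"] by (simp only: complex_cnj_diff complex_cnj_one not_False_eq_True)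
    have "cmod x = r"
      using z w r_nonneg by (simp add: x_def norm_mult)
    then have xx: "of_real (r\<^sup>2) = x * cnj x"
      by (simp flip: complex_norm_square)
    have K: "K z = 1 / (1 - x)" by (simp add: K_def x_def)
    have "x * (1 / (1 - x)) = 1 / (1 - x) - 1" "x * (1 / (1 - cnj x) - 1) = x * cnj x * (1 / (1 - cnj x))"
      using nz nz' by (simp_all add: field_simps)
    then have key: "x * (1 / (1 - x) + cnj (1 / (1 - x)) - 1) = 1 / (1 - x) - 1 + x * cnj x * cnj (1 / (1 - x))"
      by (simp add: algebra_simps)
    show "f z * (of_real r * w * cnj z * of_real (2 * pi * poisson_kernel r (w / z)))
        = f z * K z - f z + of_real (r\<^sup>2) * (f z * cnj (K z))"
      unfolding two_pi_poisson_kernel[OF w z] x_def[symmetric] K xx key by (simp add: algebra_simps)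
  qed
  also have "\<dots> = dilate f w"
    using int_f int_K int_cK
    by (simp add: mean coanalytic) (simp add: dilate_def cauchy_transform_def K_def)
  finally show ?thesis by simp
qed

text \<open>
  Jensen's inequality for the probability measure \<open>2 * pi * P\<^sub>r dm\<close>, in the form of
  Cauchy--Schwarz with the square root \<open>s\<close> of the kernel split off both factors.
\<close>

lemma dilate_sq_le:
  assumes f: "f \<in> H2_0" and w: "cmod w = 1"
  shows "(cmod (dilate f w))\<^sup>2 \<le> (\<integral>z. r\<^sup>2 * (2 * pi) * (poisson_kernel r (w / z) * (cmod (f z))\<^sup>2) \<partial>circle_haar)"
    and "integrable circle_haar (\<lambda>z. poisson_kernel r (w / z) * (cmod (f z))\<^sup>2)"
proof -
  have fL: "f \<in> L2_circle" using f by (intro H2_L2_circle H2_0_H2)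
  have [measurable]: "f \<in> borel_measurable circle_haar" by (rule L2_circle_measurable[OF fL])
  have P_meas [measurable]: "(\<lambda>z. poisson_kernel r (w / z)) \<in> borel_measurable circle_haar"
    unfolding poisson_kernel_def by measurable
  show int: "integrable circle_haar (\<lambda>z. poisson_kernel r (w / z) * (cmod (f z))\<^sup>2)"
  proof (rule Bochner_Integration.integrable_bound)
    show "integrable circle_haar (\<lambda>z. 1 / (1 - r)\<^sup>2 * (cmod (f z))\<^sup>2)"
      by (intro integrable_mult_right L2_circle_integrable_sq fL)
    show "AE z in circle_haar. norm (poisson_kernel r (w / z) * (cmod (f z))\<^sup>2)
        \<le> norm (1 / (1 - r)\<^sup>2 * (cmod (f z))\<^sup>2)"
    proof (rule AE_I2)
      fix z assume "z \<in> space circle_haar"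
      then show "norm (poisson_kernel r (w / z) * (cmod (f z))\<^sup>2) \<le> norm (1 / (1 - r)\<^sup>2 * (cmod (f z))\<^sup>2)"
        using poisson_kernel_bounds[OF w, of z] unfolding norm_mult by (intro mult_right_mono) auto
    qed
  qed measurable
  define s where "s = (\<lambda>z. sqrt (2 * pi * poisson_kernel r (w / z)))"
  have s2: "(s z)\<^sup>2 = 2 * pi * poisson_kernel r (w / z)" if "cmod z = 1" for z
    using poisson_kernel_bounds(1)[OF w that] by (simp add: s_def)
  define F where "F = (\<lambda>z. f z * (of_real r * w * cnj z * of_real (s z)))"
  have F2: "(cmod (F z))\<^sup>2 = r\<^sup>2 * (2 * pi) * (poisson_kernel r (w / z) * (cmod (f z))\<^sup>2)"
    if "z \<in> space circle_haar" for z
    using that w s2[of z] by (simp add: F_def norm_mult power_mult_distrib mult_ac)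
  have S2: "(cmod (complex_of_real (s z)))\<^sup>2 = 2 * pi * poisson_kernel r (w / z)"
    if "z \<in> space circle_haar" for z
    using that s2[of z] by simp
  have [measurable]: "s \<in> borel_measurable circle_haar" unfolding s_def by measurable
  have "(cmod (\<integral>z. F z * of_real (s z) \<partial>circle_haar))\<^sup>2
      \<le> (\<integral>z. (cmod (F z))\<^sup>2 \<partial>circle_haar) * (\<integral>z. (cmod (complex_of_real (s z)))\<^sup>2 \<partial>circle_haar)"
  proof (rule Cauchy_Schwarz_integral_norm)
    show "F \<in> borel_measurable circle_haar" unfolding F_def by measurable
    show "integrable circle_haar (\<lambda>z. (cmod (F z))\<^sup>2)"
      using int by (subst Bochner_Integration.integrable_cong[OF refl F2]) auto
    show "integrable circle_haar (\<lambda>z. (cmod (complex_of_real (s z)))\<^sup>2)"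
      using haar.integrable_poisson_kernel[OF w]
      by (subst Bochner_Integration.integrable_cong[OF refl S2]) auto
  qed measurable
  also have "(\<integral>z. (cmod (complex_of_real (s z)))\<^sup>2 \<partial>circle_haar) = 2 * pi * poisson_conv r circle_haar w"
    unfolding poisson_conv_def by (subst Bochner_Integration.integral_cong[OF refl S2]) auto
  also have "(\<integral>z. (cmod (F z))\<^sup>2 \<partial>circle_haar)
      = (\<integral>z. r\<^sup>2 * (2 * pi) * (poisson_kernel r (w / z) * (cmod (f z))\<^sup>2) \<partial>circle_haar)"
    by (intro Bochner_Integration.integral_cong refl F2)
  also have "(\<integral>z. F z * of_real (s z) \<partial>circle_haar) = dilate f w"
    unfolding dilate_eq_integral_poisson[OF f w]
  proof (intro Bochner_Integration.integral_cong refl)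
    fix z assume "z \<in> space circle_haar"
    then have "complex_of_real (s z) * complex_of_real (s z) = of_real (2 * pi * poisson_kernel r (w / z))"
      using s2[of z] by (simp add: power2_eq_square flip: of_real_mult)
    then show "F z * of_real (s z)
        = f z * (of_real r * w * cnj z * of_real (2 * pi * poisson_kernel r (w / z)))"
      by (simp only: F_def mult.assoc)
  qed
  finally show "(cmod (dilate f w))\<^sup>2
      \<le> (\<integral>z. r\<^sup>2 * (2 * pi) * (poisson_kernel r (w / z) * (cmod (f z))\<^sup>2) \<partial>circle_haar)"
    by (simp only: poisson_conv_haar[OF w] mult_1_right)
qed

lemma integrable_weighted_sq:
  assumes f: "f \<in> L2_circle"
  shows "integrable circle_haar (\<lambda>z. (cmod (f z))\<^sup>2 * poisson_conv r N z)"
proof (rule Bochner_Integration.integrable_bound)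
  let ?B = "measure N (sphere 0 1) / (1 - r)\<^sup>2"
  have [measurable]: "f \<in> borel_measurable circle_haar" by (rule L2_circle_measurable[OF f])
  show "integrable circle_haar (\<lambda>z. (cmod (f z))\<^sup>2 * ?B)"
    by (intro integrable_mult_left L2_circle_integrable_sq f)
  show "AE z in circle_haar. norm ((cmod (f z))\<^sup>2 * poisson_conv r N z) \<le> norm ((cmod (f z))\<^sup>2 * ?B)"
  proof (rule AE_I2)
    fix z assume "z \<in> space circle_haar"
    then show "norm ((cmod (f z))\<^sup>2 * poisson_conv r N z) \<le> norm ((cmod (f z))\<^sup>2 * ?B)"
      using poisson_conv_bound[of z] poisson_conv_nonneg[of z]
      unfolding norm_mult by (intro mult_left_mono) auto
  qed
  show "(\<lambda>z. (cmod (f z))\<^sup>2 * poisson_conv r N z) \<in> borel_measurable circle_haar"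
    by measurable
qed

text \<open>
  The Poisson kernel is symmetric on the circle, so after exchanging the integrals the inner one is
  again the Poisson integral of \<open>N\<close>. The exchange is done for nonnegative integrals, where it needs
  only measurability.
\<close>

lemma integral_dilate_sq_le:
  assumes f: "f \<in> H2_0"
  shows "(\<integral>w. (cmod (dilate f w))\<^sup>2 \<partial>N)
      \<le> r\<^sup>2 * (2 * pi) * (\<integral>z. (cmod (f z))\<^sup>2 * poisson_conv r N z \<partial>circle_haar)"
    and "integrable N (\<lambda>w. (cmod (dilate f w))\<^sup>2)"
proof -
  have fL: "f \<in> L2_circle" using f by (intro H2_L2_circle H2_0_H2)
  have f_meas [measurable]: "f \<in> borel_measurable circle_haar" by (rule L2_circle_measurable[OF fL])
  note dilate_meas = dilate_measurable[OF fL, measurable]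
  show int_dilate: "integrable N (\<lambda>w. (cmod (dilate f w))\<^sup>2)"
  proof (rule integrable_const_bound)
    show "AE w in N. norm ((cmod (dilate f w))\<^sup>2) \<le> (sqrt (L2_sq f) / (1 - r))\<^sup>2"
      using dilate_bound[OF fL] by (intro AE_I2) (auto intro!: power_mono)
  qed measurable
  interpret pair: pair_sigma_finite N circle_haar
    by unfold_locales
  define k where "k = (\<lambda>w z. r\<^sup>2 * (2 * pi) * (poisson_kernel r (w / z) * (cmod (f z))\<^sup>2))"
  have k_meas: "(\<lambda>(w, z). ennreal (k w z)) \<in> borel_measurable (N \<Otimes>\<^sub>M circle_haar)"
    unfolding k_def poisson_kernel_def by measurable
  have k_nonneg: "0 \<le> k w z" if "cmod w = 1" "cmod z = 1" for w z
    using poisson_kernel_bounds(1)[OF that] by (simp add: k_def)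
  have "ennreal (\<integral>w. (cmod (dilate f w))\<^sup>2 \<partial>N) = (\<integral>\<^sup>+w. ennreal ((cmod (dilate f w))\<^sup>2) \<partial>N)"
    using int_dilate by (simp add: nn_integral_eq_integral)
  also have "\<dots> \<le> (\<integral>\<^sup>+w. (\<integral>\<^sup>+z. ennreal (k w z) \<partial>circle_haar) \<partial>N)"
  proof (rule nn_integral_mono)
    fix w assume "w \<in> space N"
    then have w: "cmod w = 1" by simp
    have "(\<integral>\<^sup>+z. ennreal (k w z) \<partial>circle_haar) = ennreal (\<integral>z. k w z \<partial>circle_haar)"
      using k_nonneg[OF w] dilate_sq_le(2)[OF f w]
      by (intro nn_integral_eq_integral) (auto simp: k_def intro!: AE_I2)
    then show "ennreal ((cmod (dilate f w))\<^sup>2) \<le> (\<integral>\<^sup>+z. ennreal (k w z) \<partial>circle_haar)"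
      using dilate_sq_le(1)[OF f w] by (simp add: k_def ennreal_leI)
  qed
  also have "\<dots> = (\<integral>\<^sup>+z. (\<integral>\<^sup>+w. ennreal (k w z) \<partial>N) \<partial>circle_haar)"
    by (rule pair.Fubini'[OF k_meas, symmetric])
  also have "\<dots> = (\<integral>\<^sup>+z. ennreal (r\<^sup>2 * (2 * pi) * ((cmod (f z))\<^sup>2 * poisson_conv r N z)) \<partial>circle_haar)"
  proof (rule nn_integral_cong)
    fix z assume "z \<in> space circle_haar"
    then have z: "cmod z = 1" by simp
    have eq: "k w z = r\<^sup>2 * (2 * pi) * ((cmod (f z))\<^sup>2 * poisson_kernel r (z / w))" if "w \<in> space N" for w
      using that z poisson_kernel_commute[of w z] by (simp add: k_def mult_ac)
    have "(\<integral>\<^sup>+w. ennreal (k w z) \<partial>N)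
        = (\<integral>\<^sup>+w. ennreal (r\<^sup>2 * (2 * pi) * ((cmod (f z))\<^sup>2 * poisson_kernel r (z / w))) \<partial>N)"
      by (intro nn_integral_cong) (simp only: eq)
    also have "\<dots> = ennreal (\<integral>w. r\<^sup>2 * (2 * pi) * ((cmod (f z))\<^sup>2 * poisson_kernel r (z / w)) \<partial>N)"
      using integrable_poisson_kernel[OF z] poisson_kernel_bounds(1)[OF z]
      by (intro nn_integral_eq_integral) (auto intro!: AE_I2 simp: less_imp_le)
    finally show "(\<integral>\<^sup>+w. ennreal (k w z) \<partial>N)
        = ennreal (r\<^sup>2 * (2 * pi) * ((cmod (f z))\<^sup>2 * poisson_conv r N z))"
      by (simp add: poisson_conv_def)
  qed
  also have "\<dots> = ennreal (\<integral>z. r\<^sup>2 * (2 * pi) * ((cmod (f z))\<^sup>2 * poisson_conv r N z) \<partial>circle_haar)"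
    using integrable_weighted_sq[OF fL] poisson_conv_nonneg
    by (intro nn_integral_eq_integral integrable_mult_right) (auto intro!: AE_I2)
  finally have "ennreal (\<integral>w. (cmod (dilate f w))\<^sup>2 \<partial>N)
      \<le> ennreal (r\<^sup>2 * (2 * pi) * (\<integral>z. (cmod (f z))\<^sup>2 * poisson_conv r N z \<partial>circle_haar))"
    by simp
  moreover have "0 \<le> (\<integral>z. (cmod (f z))\<^sup>2 * poisson_conv r N z \<partial>circle_haar)"
    using poisson_conv_nonneg by (intro integral_nonneg_AE AE_I2) auto
  ultimately show "(\<integral>w. (cmod (dilate f w))\<^sup>2 \<partial>N)
      \<le> r\<^sup>2 * (2 * pi) * (\<integral>z. (cmod (f z))\<^sup>2 * poisson_conv r N z \<partial>circle_haar)"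
    by (subst (asm) ennreal_le_iff) auto
qed

lemma hardy_part_sq_le:
  assumes f: "f \<in> H2_0" and z: "cmod z = 1"
  shows "(cmod (hardy_part f z))\<^sup>2
      \<le> (r / sqrt (1 - r\<^sup>2) * weighted_L2_norm (poisson_conv r N) f)\<^sup>2 * poisson_conv r N z"
proof -
  have fL: "f \<in> L2_circle" using f by (intro H2_L2_circle H2_0_H2)
  define W where "W = (\<integral>z. (cmod (f z))\<^sup>2 * poisson_conv r N z \<partial>circle_haar)"
  have W: "0 \<le> W"
    unfolding W_def using poisson_conv_nonneg by (intro integral_nonneg_AE AE_I2) auto
  have "(cmod (cauchy_transform N r (\<lambda>w. cnj (dilate f w)) z))\<^sup>2
      \<le> (\<integral>w. (cmod (dilate f w))\<^sup>2 \<partial>N) * (2 * pi / (1 - r\<^sup>2) * poisson_conv r N z)"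
    using cauchy_transform_sq_le[of "\<lambda>w. cnj (dilate f w)", OF _ _ z]
      integral_dilate_sq_le(2)[OF f] dilate_measurable[OF fL] by simp
  also have "\<dots> \<le> (r\<^sup>2 * (2 * pi) * W) * (2 * pi / (1 - r\<^sup>2) * poisson_conv r N z)"
    using integral_dilate_sq_le(1)[OF f] one_minus_r_sq_pos poisson_conv_nonneg[OF z]
    unfolding W_def by (intro mult_right_mono) auto
  also have "\<dots> = (2 * pi)\<^sup>2 * (r\<^sup>2 / (1 - r\<^sup>2) * W * poisson_conv r N z)"
    by (simp add: power2_eq_square)
  finally have "(cmod (hardy_part f z))\<^sup>2 \<le> r\<^sup>2 / (1 - r\<^sup>2) * W * poisson_conv r N z"
    by (simp add: hardy_part_def norm_divide power_divide divide_le_eq mult_ac)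
  also have "r\<^sup>2 / (1 - r\<^sup>2) * W = (r / sqrt (1 - r\<^sup>2) * weighted_L2_norm (poisson_conv r N) f)\<^sup>2"
    using W one_minus_r_sq_pos
    by (simp add: power_mult_distrib power_divide weighted_L2_norm_def W_def)
  finally show ?thesis .
qed

lemma Linf_norm_hankel:
  assumes f: "f \<in> H2_0"
  shows "Linf_norm_circle (\<lambda>z. hankel (\<lambda>w. of_real (poisson_conv r N w)) f z / of_real (sqrt (poisson_conv r N z)))
    = esssup circle_haar (\<lambda>z. ereal (cmod (hardy_part f z) / sqrt (poisson_conv r N z)))"
proof -
  have fL: "f \<in> L2_circle" using f by (intro H2_L2_circle H2_0_H2)
  have [measurable]: "hardy_part f \<in> borel_measurable circle_haar"
    "hankel (\<lambda>w. of_real (poisson_conv r N w)) f \<in> borel_measurable circle_haar"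
    using hankel_eq_cnj_hardy_part(1)[OF f] hardy_part_H2[OF fL]
    by (auto intro: L2_circle_measurable H2_L2_circle)
  show ?thesis unfolding Linf_norm_circle_def
  proof (rule esssup_AE_cong)
    show "AE z in circle_haar. ereal (cmod (hankel (\<lambda>w. of_real (poisson_conv r N w)) f z / of_real (sqrt (poisson_conv r N z))))
        = ereal (cmod (hardy_part f z) / sqrt (poisson_conv r N z))"
      using hankel_eq_cnj_hardy_part(2)[OF f] AE_space
      by eventually_elim (simp add: norm_divide poisson_conv_nonneg)
  qed measurable
qed

lemma Linf_norm_R_plus:
  assumes f: "f \<in> H2_0"
  shows "Linf_norm_circle (\<lambda>z. R_plus (\<lambda>w. cnj (f w) * of_real (poisson_conv r N w)) z / of_real (sqrt (poisson_conv r N z)))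
    = esssup circle_haar (\<lambda>z. ereal (cmod (hardy_part f z) / sqrt (poisson_conv r N z)))"
proof -
  have fL: "f \<in> L2_circle" using f by (intro H2_L2_circle H2_0_H2)
  have [measurable]: "hardy_part f \<in> borel_measurable circle_haar"
    "R_plus (\<lambda>w. cnj (f w) * of_real (poisson_conv r N w)) \<in> borel_measurable circle_haar"
    using R_plus_eq_hardy_part(1)[OF f] hardy_part_H2[OF fL]
    by (auto intro: L2_circle_measurable H2_L2_circle)
  show ?thesis unfolding Linf_norm_circle_def
  proof (rule esssup_AE_cong)
    show "AE z in circle_haar. ereal (cmod (R_plus (\<lambda>w. cnj (f w) * of_real (poisson_conv r N w)) z / of_real (sqrt (poisson_conv r N z))))
        = ereal (cmod (hardy_part f z) / sqrt (poisson_conv r N z))"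
      using R_plus_eq_hardy_part(2)[OF f] AE_space
      by eventually_elim (simp add: norm_divide poisson_conv_nonneg)
  qed measurable
qed

lemma esssup_hardy_part_le:
  assumes f: "f \<in> H2_0" and nz: "emeasure N (sphere 0 1) \<noteq> 0"
  shows "esssup circle_haar (\<lambda>z. ereal (cmod (hardy_part f z) / sqrt (poisson_conv r N z)))
    \<le> ereal (r / sqrt (1 - r\<^sup>2) * weighted_L2_norm (poisson_conv r N) f)"
proof (rule esssup_I)
  have fL: "f \<in> L2_circle" using f by (intro H2_L2_circle H2_0_H2)
  have [measurable]: "hardy_part f \<in> borel_measurable circle_haar"
    by (intro L2_circle_measurable H2_L2_circle hardy_part_H2 fL)
  show "(\<lambda>z. ereal (cmod (hardy_part f z) / sqrt (poisson_conv r N z))) \<in> borel_measurable circle_haar"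
    by measurable
  let ?C = "r / sqrt (1 - r\<^sup>2) * weighted_L2_norm (poisson_conv r N) f"
  have C: "0 \<le> ?C"
  proof -
    have "0 \<le> weighted_L2_norm (poisson_conv r N) f"
      unfolding weighted_L2_norm_def
      using poisson_conv_nonneg by (intro real_sqrt_ge_zero integral_nonneg_AE AE_I2) auto
    then show ?thesis
      using r_nonneg one_minus_r_sq_pos by simp
  qed
  have "cmod (hardy_part f z) / sqrt (poisson_conv r N z) \<le> ?C" if "cmod z = 1" for z
  proof -
    have pos: "0 < poisson_conv r N z" by (rule poisson_conv_pos[OF nz that])
    have "cmod (hardy_part f z) \<le> sqrt (?C\<^sup>2 * poisson_conv r N z)"
      by (rule real_le_rsqrt[OF hardy_part_sq_le[OF f that]])
    also have "\<dots> = ?C * sqrt (poisson_conv r N z)"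
      by (simp only: real_sqrt_mult real_sqrt_abs abs_of_nonneg[OF C])
    finally show ?thesis using pos by (simp add: divide_le_eq)
  qed
  then show "AE z in circle_haar. ereal (cmod (hardy_part f z) / sqrt (poisson_conv r N z)) \<le> ereal ?C"
    by (intro AE_I2) simp
qed

end

section \<open>Sharpness\<close>

lemma radon_return: "radon_on_circle (return circle_borel 1)"
  unfolding radon_on_circle_def
proof (intro conjI allI ballI impI)
  have compact_sets: "K \<in> sets circle_borel" if "compact K" "K \<subseteq> sphere 0 1" for K :: "complex set"
    using that by (auto simp: circle_borel_def sets_restrict_space compact_imp_closed intro!: image_eqI[of _ _ K])
  show "emeasure (return circle_borel 1) K < \<infinity>" if "compact K \<and> K \<subseteq> sphere 0 1" for K :: "complex set"
    using that compact_sets[of K] by (simp add: indicator_def)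
  fix A :: "complex set" assume A: "A \<in> sets (return circle_borel 1)"
  then have A_sub: "A \<subseteq> sphere 0 1" "A \<in> sets circle_borel"
    using sets.sets_into_space[of A circle_borel] by auto
  show "emeasure (return circle_borel 1) A
      = (SUP K\<in>{K. compact K \<and> K \<subseteq> A}. emeasure (return circle_borel 1) K)"
  proof (rule antisym)
    show "emeasure (return circle_borel 1) A
        \<le> (SUP K\<in>{K. compact K \<and> K \<subseteq> A}. emeasure (return circle_borel 1) K)"
    proof (cases "1 \<in> A")
      case True
      then show ?thesis
        using A_sub compact_sets[of "{1}"] by (intro SUP_upper2[of "{1}"]) auto
    qed (use A_sub in auto)
    show "(SUP K\<in>{K. compact K \<and> K \<subseteq> A}. emeasure (return circle_borel 1) K)
        \<le> emeasure (return circle_borel 1) A"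
      using A by (intro SUP_least emeasure_mono) auto
  qed
qed simp

text \<open>Equality holds at every point of the circle for the unit mass at \<open>1\<close> and \<open>f(z) = z\<close>.\<close>

lemma point_mass_extremal:
  assumes "0 \<le> r" "r < 1"
  defines "\<mu> \<equiv> return circle_borel 1"
  shows "Linf_norm_circle (\<lambda>z. hankel (\<lambda>w. of_real (poisson_conv r \<mu> w)) (\<lambda>z. z) z / of_real (sqrt (poisson_conv r \<mu> z)))
      = ereal (r / sqrt (1 - r\<^sup>2) * weighted_L2_norm (poisson_conv r \<mu>) (\<lambda>z. z))"
    and "0 < weighted_L2_norm (poisson_conv r \<mu>) (\<lambda>z. z)"
proof -
  interpret circle_measure \<mu> r
    using assms prob_space_return[of 1 circle_borel]
    by (auto simp: circle_measure_def circle_measure_axioms_def \<mu>_def intro: prob_space.finite_measure)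
  interpret haar: circle_measure circle_haar r
    by unfold_locales (auto simp: assms)
  have integral: "(\<integral>w. g w \<partial>\<mu>) = g 1" if "g \<in> borel_measurable \<mu>" for g :: "complex \<Rightarrow> 'a::{banach, second_countable_topology}"
    using that unfolding \<mu>_def by (intro integral_return) (auto cong: measurable_cong_sets)
  have phi: "poisson_conv r \<mu> z = poisson_kernel r z" for z
    unfolding poisson_conv_def by (subst integral) (auto simp: poisson_kernel_def)
  have f: "(\<lambda>z. z) \<in> H2_0" using H2_0_monomial[of 1] by simp
  have part: "hardy_part (\<lambda>z. z) z = of_real r / (1 - of_real r * z) / (2 * pi)" for z
  proof -
    have "cauchy_transform \<mu> r (\<lambda>w. cnj (dilate (\<lambda>z. z) w)) z = cnj (dilate (\<lambda>z. z) 1) / (1 - of_real r * z * cnj 1)"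
      unfolding cauchy_transform_def using dilate_measurable[OF H2_L2_circle[OF H2_0_H2[OF f]]]
      by (subst integral) auto
    then show ?thesis
      using dilate_power[of 1 1] by (simp add: hardy_part_def)
  qed
  have norm: "weighted_L2_norm (poisson_conv r \<mu>) (\<lambda>z. z) = 1 / sqrt (2 * pi)"
  proof -
    have "(\<integral>z. (cmod z)\<^sup>2 * poisson_conv r \<mu> z \<partial>circle_haar) = poisson_conv r circle_haar 1"
      unfolding poisson_conv_def[of r circle_haar]
      using poisson_kernel_commute[of 1] by (intro Bochner_Integration.integral_cong) (auto simp: phi)
    also have "\<dots> = 1 / (2 * pi)"
      using poisson_conv_haar[of 1] by (simp add: field_simps)
    finally show ?thesis
      by (simp add: weighted_L2_norm_def real_sqrt_divide)
  qed
  then show "0 < weighted_L2_norm (poisson_conv r \<mu>) (\<lambda>z. z)" by simp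
  have ratio: "cmod (hardy_part (\<lambda>z. z) z) / sqrt (poisson_conv r \<mu> z) = r / sqrt (1 - r\<^sup>2) * (1 / sqrt (2 * pi))"
    if z: "cmod z = 1" for z
  proof -
    have "1 - of_real r * z \<noteq> 0" using cauchy_kernel_nonzero[OF z, of 1] by simp
    then have c: "0 < cmod (1 - of_real r * z)" by simp
    have "poisson_conv r \<mu> z = (1 - r\<^sup>2) / (2 * pi) / (cmod (1 - of_real r * z))\<^sup>2"
      by (simp add: phi poisson_kernel_def)
    then have phi': "sqrt (poisson_conv r \<mu> z)
        = sqrt (1 - r\<^sup>2) / sqrt (2 * pi) / cmod (1 - of_real r * z)"
      by (simp only: real_sqrt_divide real_sqrt_abs abs_norm_cancel)
    have part': "cmod (hardy_part (\<lambda>z. z) z) = r / cmod (1 - of_real r * z) / (sqrt (2 * pi) * sqrt (2 * pi))"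
      using \<open>0 \<le> r\<close> by (simp add: part norm_divide norm_mult)
    have frac: "(r / c / (s * s)) / (t / s / c) = r / t * (1 / s)" if "0 < c" "0 < s" "0 < t" for c s t :: real
      using that by (simp add: field_simps)
    show ?thesis
      unfolding phi' part' by (rule frac[OF c]) (use one_minus_r_sq_pos in auto)
  qed
  have "esssup circle_haar (\<lambda>z. ereal (cmod (hardy_part (\<lambda>z. z) z) / sqrt (poisson_conv r \<mu> z)))
      = esssup circle_haar (\<lambda>z. ereal (r / sqrt (1 - r\<^sup>2) * (1 / sqrt (2 * pi))))"
  proof (rule esssup_AE_cong)
    have [measurable]: "hardy_part (\<lambda>z. z) \<in> borel_measurable circle_haar"
      by (intro L2_circle_measurable H2_L2_circle hardy_part_H2 H2_0_H2 f)
    show "(\<lambda>z. ereal (cmod (hardy_part (\<lambda>z. z) z) / sqrt (poisson_conv r \<mu> z))) \<in> borel_measurable circle_haar"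
      by measurable
    show "AE z in circle_haar. ereal (cmod (hardy_part (\<lambda>z. z) z) / sqrt (poisson_conv r \<mu> z))
        = ereal (r / sqrt (1 - r\<^sup>2) * (1 / sqrt (2 * pi)))"
      using ratio by (intro AE_I2) simp
  qed simp
  also have "\<dots> = ereal (r / sqrt (1 - r\<^sup>2) * (1 / sqrt (2 * pi)))"
    using circle_haar.emeasure_space_1 by (intro esssup_const) simp
  finally show "Linf_norm_circle (\<lambda>z. hankel (\<lambda>w. of_real (poisson_conv r \<mu> w)) (\<lambda>z. z) z / of_real (sqrt (poisson_conv r \<mu> z)))
      = ereal (r / sqrt (1 - r\<^sup>2) * weighted_L2_norm (poisson_conv r \<mu>) (\<lambda>z. z))"
    unfolding Linf_norm_hankel[OF f] norm .
qed

lemma radon_circle_measure: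
  assumes "0 \<le> r" "r < 1" "radon_on_circle \<mu>"
  shows "circle_measure \<mu> r"
proof -
  have sets: "sets \<mu> = sets circle_borel"
    using assms(3) by (simp add: radon_on_circle_def)
  have "emeasure \<mu> (sphere 0 1) < \<infinity>"
    using assms(3) by (simp add: radon_on_circle_def)
  then have "finite_measure \<mu>"
    using sets_eq_imp_space_eq[OF sets] by (intro finite_measureI) simp
  with sets assms show ?thesis
    by (simp add: circle_measure_def circle_measure_axioms_def)
qed

theorem proposition1p15:
  fixes r :: real
  assumes "0 \<le> r" and "r < 1"
  shows
    "(\<forall>\<mu> f. radon_on_circle \<mu> \<and> emeasure \<mu> (sphere 0 1) \<noteq> 0 \<and> f \<in> H2_0 \<longrightarrow>
        (let \<phi> = poisson_conv r \<mu> in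
          Linf_norm_circle (\<lambda>z. hankel (\<lambda>w. of_real (\<phi> w)) f z / of_real (sqrt (\<phi> z)))
            = Linf_norm_circle
                (\<lambda>z. R_plus (\<lambda>w. cnj (f w) * of_real (\<phi> w)) z / of_real (sqrt (\<phi> z))) \<and>
          Linf_norm_circle
              (\<lambda>z. R_plus (\<lambda>w. cnj (f w) * of_real (\<phi> w)) z / of_real (sqrt (\<phi> z)))
            \<le> ereal (r / sqrt (1 - r\<^sup>2) * weighted_L2_norm \<phi> f))) \<and>
     (\<forall>C::real.
        (\<forall>\<mu> f. radon_on_circle \<mu> \<and> emeasure \<mu> (sphere 0 1) \<noteq> 0 \<and> f \<in> H2_0 \<longrightarrow>
          (let \<phi> = poisson_conv r \<mu> in
            Linf_norm_circle (\<lambda>z. hankel (\<lambda>w. of_real (\<phi> w)) f z / of_real (sqrt (\<phi> z)))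
              \<le> ereal (C * weighted_L2_norm \<phi> f)))
        \<longrightarrow> r / sqrt (1 - r\<^sup>2) \<le> C) \<and>
     (r = 1 / sqrt 2 \<longrightarrow>
        (\<forall>\<mu> f. radon_on_circle \<mu> \<and> emeasure \<mu> (sphere 0 1) \<noteq> 0 \<and> f \<in> H2_0 \<longrightarrow>
          (let \<phi> = poisson_conv r \<mu> in
            Linf_norm_circle (\<lambda>z. hankel (\<lambda>w. of_real (\<phi> w)) f z / of_real (sqrt (\<phi> z)))
              \<le> ereal (weighted_L2_norm \<phi> f))))"
proof -
  have bound: "Linf_norm_circle (\<lambda>z. hankel (\<lambda>w. of_real (poisson_conv r \<mu> w)) f z / of_real (sqrt (poisson_conv r \<mu> z)))
      = Linf_norm_circle (\<lambda>z. R_plus (\<lambda>w. cnj (f w) * of_real (poisson_conv r \<mu> w)) z / of_real (sqrt (poisson_conv r \<mu> z)))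
      \<and> Linf_norm_circle (\<lambda>z. R_plus (\<lambda>w. cnj (f w) * of_real (poisson_conv r \<mu> w)) z / of_real (sqrt (poisson_conv r \<mu> z)))
        \<le> ereal (r / sqrt (1 - r\<^sup>2) * weighted_L2_norm (poisson_conv r \<mu>) f)"
    if "radon_on_circle \<mu> \<and> emeasure \<mu> (sphere 0 1) \<noteq> 0 \<and> f \<in> H2_0" for \<mu> f
  proof -
    interpret circle_measure \<mu> r
      using that assms by (intro radon_circle_measure) auto
    show ?thesis
      using that Linf_norm_hankel[of f] Linf_norm_R_plus[of f] esssup_hardy_part_le[of f] by auto
  qed
  have sharp: "r / sqrt (1 - r\<^sup>2) \<le> C"
    if C: "\<forall>\<mu> f. radon_on_circle \<mu> \<and> emeasure \<mu> (sphere 0 1) \<noteq> 0 \<and> f \<in> H2_0 \<longrightarrow>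
          (let \<phi> = poisson_conv r \<mu> in
            Linf_norm_circle (\<lambda>z. hankel (\<lambda>w. of_real (\<phi> w)) f z / of_real (sqrt (\<phi> z)))
              \<le> ereal (C * weighted_L2_norm \<phi> f))" for C :: real
  proof -
    let ?\<mu> = "return circle_borel 1"
    have "emeasure ?\<mu> (sphere 0 1) \<noteq> 0"
      using prob_space.emeasure_space_1[OF prob_space_return[of 1 circle_borel]] by simp
    moreover have "(\<lambda>z. z) \<in> H2_0" using H2_0_monomial[of 1] by simp
    ultimately have "ereal (r / sqrt (1 - r\<^sup>2) * weighted_L2_norm (poisson_conv r ?\<mu>) (\<lambda>z. z))
        \<le> ereal (C * weighted_L2_norm (poisson_conv r ?\<mu>) (\<lambda>z. z))"
      using C radon_return point_mass_extremal(1)[OF assms] unfolding Let_def by metis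
    then show ?thesis
      using point_mass_extremal(2)[OF assms] unfolding ereal_less_eq(3) by (rule mult_right_le_imp_le)
  qed
  have "r / sqrt (1 - r\<^sup>2) = 1" if "r = 1 / sqrt 2"
  proof -
    have "1 - r\<^sup>2 = 1 / 2" using that by (simp add: power_divide)
    then have "sqrt (1 - r\<^sup>2) = 1 / sqrt 2" by (simp only: real_sqrt_divide real_sqrt_one)
    then show ?thesis using that by simp
  qed
  then show ?thesis
    using bound sharp by (auto simp: Let_def)
qed

end
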